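(* Let $\mathcal{H}$ be a complex finite dimensional Hilbert space with $d=\dim\mathcal{H}\ge 2$, let $\mathcal{L}(\mathcal{H})_{++}$ denote the set of positive definite (i.e. invertible positive semidefinite) operators on $\mathcal{H}$, and let $\alpha\in\,]0,1[\,\cup\,]1,+\infty[$ be an arbitrary but fixed real number. Let $\phi:\mathcal{L}(\mathcal{H})_{++}\to\mathcal{L}(\mathcal{H})_{++}$ be a bijection satisfying $$D_{\alpha}^{\flat}(\phi(A)\Vert\phi(B))=D_{\alpha}^{\flat}(A\Vert B)\qquad\text{for all } A,B\in\mathcal{L}(\mathcal{H})_{++}.$$ Then there exist either a unitary or an antiunitary operator $U$ on $\mathcal{H}$ and a scalar $\lambda>0$ such that $$\phi(A)=\lambda UAU^{*}\qquad\text{for all } A\in\mathcal{L}(\mathcal{H})_{++}.$$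
   Context: For positive definite operators $A,B$ on $\mathcal{H}$ and $\alpha\in\,]0,1[\,\cup\,]1,+\infty[$, the Rényi type divergence $D_\alpha^\flat$ is defined by $$D_{\alpha}^{\flat}(A\Vert B)=(\alpha-1)^{-1}\log\left((\operatorname{Tr}A)^{-1}\operatorname{Tr}\exp\bigl(\alpha\log A+(1-\alpha)\log B\bigr)\right),$$ where $\exp$ and $\log$ of operators are understood via the functional calculus. An antiunitary operator is a bijective conjugate linear map $U$ on $\mathcal{H}$ preserving the norm; its adjoint is given by $\langle Ux,y\rangle=\overline{\langle x,U^*y\rangle}$, so $U^*=U^{-1}$. *)

theory Defs
  imports "HOL-Analysis.Analysis"
begin

(* The norm and the topology are those of the real inner product Re <x,y>. A finite-dimensional
   complex Hilbert space is a type of sort {complex_inner, euclidean_space}; the real dimension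
   DIM('a) is then twice the complex dimension. *)
class complex_inner = real_inner +
  fixes scaleC :: "complex \<Rightarrow> 'a \<Rightarrow> 'a" (infixr "*\<^sub>C" 75)
    and cinner :: "'a \<Rightarrow> 'a \<Rightarrow> complex"
  assumes scaleC_add_right: "a *\<^sub>C (x + y) = a *\<^sub>C x + a *\<^sub>C y"
    and scaleC_add_left: "(a + b) *\<^sub>C x = a *\<^sub>C x + b *\<^sub>C x"
    and scaleC_scaleC: "a *\<^sub>C (b *\<^sub>C x) = (a * b) *\<^sub>C x"
    and scaleC_of_real: "complex_of_real r *\<^sub>C x = r *\<^sub>R x"
    and cinner_add_left: "cinner (x + y) z = cinner x z + cinner y z"
    and cinner_scaleC_left: "cinner (a *\<^sub>C x) y = a * cinner x y"
    and cinner_commute: "cinner x y = cnj (cinner y x)"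
    and Re_cinner: "Re (cinner x y) = inner x y"

interpretation complex_vector: vector_space "scaleC :: complex \<Rightarrow> 'a \<Rightarrow> 'a::complex_inner"
proof
  show "1 *\<^sub>C x = x" for x :: 'a
    using scaleC_of_real[of 1 x] by simp
qed (simp_all add: scaleC_add_right scaleC_add_left scaleC_scaleC)

lemma cinner_self: "cinner x x = complex_of_real ((norm x)\<^sup>2)"
proof -
  have "Im (cinner x x) = 0"
    using arg_cong[OF cinner_commute[of x x], of Im] by simp
  then show ?thesis
    by (simp add: complex_eq_iff Re_cinner power2_norm_eq_inner)
qed

instantiation complex :: complex_inner
begin

definition scaleC_complex :: "complex \<Rightarrow> complex \<Rightarrow> complex"
  where "scaleC_complex a x = a * x"

definition cinner_complex :: "complex \<Rightarrow> complex \<Rightarrow> complex"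
  where "cinner_complex x y = x * cnj y"

instance
  by standard
    (simp_all add: scaleC_complex_def cinner_complex_def inner_complex_def algebra_simps scaleR_conv_of_real)

end

instantiation vec :: (complex_inner, finite) complex_inner
begin

definition scaleC_vec :: "complex \<Rightarrow> 'a ^ 'b \<Rightarrow> 'a ^ 'b"
  where "scaleC_vec a x = (\<chi> i. a *\<^sub>C (x $ i))"

definition cinner_vec :: "'a ^ 'b \<Rightarrow> 'a ^ 'b \<Rightarrow> complex"
  where "cinner_vec x y = (\<Sum>i\<in>UNIV. cinner (x $ i) (y $ i))"

instance
proof
  fix x y :: "'a ^ 'b"
  show "cinner x y = cnj (cinner y x)"
    unfolding cinner_vec_def cnj_sum by (intro sum.cong refl cinner_commute)
qed (simp_all add: scaleC_vec_def cinner_vec_def inner_vec_def vec_eq_iff scaleC_add_right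
    scaleC_add_left scaleC_scaleC scaleC_of_real cinner_add_left cinner_scaleC_left Re_cinner
    sum.distrib sum_distrib_left)

end

abbreviation clinear :: "('a::complex_inner \<Rightarrow> 'b::complex_inner) \<Rightarrow> bool"
  where "clinear \<equiv> Vector_Spaces.linear scaleC scaleC"

definition positive_semidefinite :: "('a::complex_inner \<Rightarrow> 'a) \<Rightarrow> bool"
  where "positive_semidefinite A \<longleftrightarrow> clinear A \<and> (\<forall>x. cinner (A x) x \<in> \<real>\<^sub>\<ge>\<^sub>0)"

definition positive_definite_ops :: "('a::complex_inner \<Rightarrow> 'a) set"
  where "positive_definite_ops = {A. positive_semidefinite A \<and> bij A}"

definition orthonormal_basis :: "'a::complex_inner set \<Rightarrow> bool"
  where "orthonormal_basis B \<longleftrightarrow>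
    (\<forall>e\<in>B. \<forall>f\<in>B. cinner e f = (if e = f then 1 else 0)) \<and> complex_vector.span B = UNIV"

(* In finite dimension an orthonormal basis exists and the value does not depend on its choice. *)
definition op_trace :: "('a::complex_inner \<Rightarrow> 'a) \<Rightarrow> complex"
  where "op_trace A = (\<Sum>e\<in>(SOME B. orthonormal_basis B). cinner (A e) e)"

definition real_eigenvalues :: "('a::complex_inner \<Rightarrow> 'a) \<Rightarrow> real set"
  where "real_eigenvalues A = {a. \<exists>x. x \<noteq> 0 \<and> A x = complex_of_real a *\<^sub>C x}"

definition eigenspace :: "('a::complex_inner \<Rightarrow> 'a) \<Rightarrow> real \<Rightarrow> 'a set"
  where "eigenspace A a = {x. A x = complex_of_real a *\<^sub>C x}"

definition orthogonal_projection :: "'a::complex_inner set \<Rightarrow> 'a \<Rightarrow> 'a"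
  where "orthogonal_projection S x = (THE y. y \<in> S \<and> (\<forall>z\<in>S. cinner (x - y) z = 0))"

(* f(A) = \<Sum> f(a) P_a, meaningful for self-adjoint A, whose spectrum consists of
   finitely many real eigenvalues. *)
definition functional_calculus :: "(real \<Rightarrow> real) \<Rightarrow> ('a::complex_inner \<Rightarrow> 'a) \<Rightarrow> 'a \<Rightarrow> 'a"
  where "functional_calculus f A =
    (\<lambda>x. \<Sum>a\<in>real_eigenvalues A. f a *\<^sub>R orthogonal_projection (eigenspace A a) x)"

abbreviation op_exp :: "('a::complex_inner \<Rightarrow> 'a) \<Rightarrow> 'a \<Rightarrow> 'a"
  where "op_exp \<equiv> functional_calculus exp"

abbreviation op_log :: "('a::complex_inner \<Rightarrow> 'a) \<Rightarrow> 'a \<Rightarrow> 'a"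
  where "op_log \<equiv> functional_calculus ln"

(* Both traces are real (and positive) for positive definite A and B, so Re discards nothing. *)
definition renyi_flat :: "real \<Rightarrow> ('a::complex_inner \<Rightarrow> 'a) \<Rightarrow> ('a \<Rightarrow> 'a) \<Rightarrow> real"
  where "renyi_flat \<alpha> A B =
    inverse (\<alpha> - 1) *
      ln (inverse (Re (op_trace A)) *
          Re (op_trace (op_exp (\<lambda>x. \<alpha> *\<^sub>R op_log A x + (1 - \<alpha>) *\<^sub>R op_log B x))))"

definition cadjoint :: "('a::complex_inner \<Rightarrow> 'a) \<Rightarrow> 'a \<Rightarrow> 'a"
  where "cadjoint U = (THE V. \<forall>x y. cinner (U x) y = cinner x (V y))"

definition unitary_op :: "('a::complex_inner \<Rightarrow> 'a) \<Rightarrow> bool"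
  where "unitary_op U \<longleftrightarrow> clinear U \<and> cadjoint U \<circ> U = id \<and> U \<circ> cadjoint U = id"

definition conjugate_linear :: "('a::complex_inner \<Rightarrow> 'b::complex_inner) \<Rightarrow> bool"
  where "conjugate_linear U \<longleftrightarrow>
    (\<forall>x y. U (x + y) = U x + U y) \<and> (\<forall>a x. U (a *\<^sub>C x) = cnj a *\<^sub>C U x)"

definition antiunitary_op :: "('a::complex_inner \<Rightarrow> 'a) \<Rightarrow> bool"
  where "antiunitary_op U \<longleftrightarrow> bij U \<and> conjugate_linear U \<and> (\<forall>x. norm (U x) = norm x)"

definition antilinear_adjoint :: "('a::complex_inner \<Rightarrow> 'a) \<Rightarrow> 'a \<Rightarrow> 'a"
  where "antilinear_adjoint U = (THE V. \<forall>x y. cinner (U x) y = cnj (cinner x (V y)))"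

end

theory Submission
  imports Defs
begin

text \<open>
  Put \<open>\<psi> = log \<circ> \<phi> \<circ> exp\<close>, a bijection of the Hermitian operators that preserves
  \<open>Tr exp (\<alpha> X + (1 - \<alpha>) Y) / Tr exp X\<close>. For Hermitian \<open>D\<close> one has \<open>D \<le> c I\<close> iff
  \<open>Tr exp (Z + D) \<le> e\<^sup>c Tr exp Z\<close> for all \<open>Z\<close>: the direction from right to left uses
  \<open>Z = - n (I - P)\<close> with a rank one projection \<open>P\<close> and \<open>n \<rightarrow> \<infinity>\<close>. As
  \<open>\<alpha> X + (1 - \<alpha>) Y\<close> runs through all \<open>Z\<close> when \<open>X\<close> does, \<open>\<psi>\<close> preserves
  \<open>Y' - Y \<le> c I\<close>; hence it is an isometry for the operator norm, and by Mazur--Ulam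
  \<open>\<psi> X = L X + Y\<^sub>0\<close> with \<open>L\<close> linear. \<open>L\<close> preserves the largest eigenvalue, so it maps rank one
  projections to rank one projections and orthogonal ones to orthogonal ones; thus it is a Jordan
  map, \<open>L (T\<^sup>2) = (L T)\<^sup>2\<close>. With \<open>L (e e\<^sup>*) = f f\<^sup>*\<close>, the map
  \<open>U x = L (x e\<^sup>* + e x\<^sup>*) f\<close> on the orthogonal complement of \<open>e\<close> is a real-linear
  isometry with \<open>L (x x\<^sup>*) = (U x) (U x)\<^sup>*\<close>, and it extends to a unitary or antiunitary
  implementation of \<open>L\<close>. Since \<open>L\<close> preserves the trace of the exponential,
  \<open>Tr exp (Z + Y\<^sub>0)\<close> is a constant multiple of \<open>Tr exp Z\<close>, which makes \<open>Y\<^sub>0\<close> scalar.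
\<close>

section \<open>Complex inner product spaces\<close>

lemma cinner_add_right: "cinner x (y + z) = cinner x y + cinner x (z::'a::complex_inner)"
  by (metis cinner_add_left cinner_commute complex_cnj_add)

lemma cinner_scaleC_right: "cinner x (a *\<^sub>C y) = cnj a * cinner x (y::'a::complex_inner)"
  by (metis cinner_scaleC_left cinner_commute complex_cnj_mult)

lemma cinner_zero_left [simp]: "cinner 0 (x::'a::complex_inner) = 0"
  using cinner_add_left[of 0 0 x] by simp

lemma cinner_zero_right [simp]: "cinner (x::'a::complex_inner) 0 = 0"
  using cinner_add_right[of x 0 0] by simp

lemma cinner_scaleR_left: "cinner (r *\<^sub>R x) y = of_real r * cinner x (y::'a::complex_inner)"
  by (metis cinner_scaleC_left scaleC_of_real)

lemma cinner_scaleR_right: "cinner x (r *\<^sub>R y) = of_real r * cinner x (y::'a::complex_inner)"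
  by (metis cinner_scaleC_right scaleC_of_real complex_cnj_complex_of_real)

lemma cinner_minus_left: "cinner (- x) y = - cinner x (y::'a::complex_inner)"
  using cinner_scaleR_left[of "-1" x y] by simp

lemma cinner_minus_right: "cinner x (- y) = - cinner x (y::'a::complex_inner)"
  using cinner_scaleR_right[of x "-1" y] by simp

lemma cinner_diff_left: "cinner (x - y) z = cinner x z - cinner y (z::'a::complex_inner)"
  using cinner_add_left[of x "-y" z] by (simp add: cinner_minus_left)

lemma cinner_diff_right: "cinner x (y - z) = cinner x y - cinner x (z::'a::complex_inner)"
  using cinner_add_right[of x y "-z"] by (simp add: cinner_minus_right)

lemma cinner_sum_left: "cinner (sum f A) y = (\<Sum>i\<in>A. cinner (f i) (y::'a::complex_inner))"
  by (induction A rule: infinite_finite_induct) (simp_all add: cinner_add_left)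

lemmas cinner_simps = cinner_add_left cinner_add_right cinner_scaleC_left cinner_scaleC_right
  cinner_scaleR_left cinner_scaleR_right cinner_minus_left cinner_minus_right
  cinner_diff_left cinner_diff_right

lemma cinner_eq_zero_iff [simp]: "cinner x x = 0 \<longleftrightarrow> (x::'a::complex_inner) = 0"
  by (simp add: cinner_self)

lemma scaleC_scaleR: "a *\<^sub>C (r *\<^sub>R x) = r *\<^sub>R (a *\<^sub>C (x::'a::complex_inner))"
  by (metis scaleC_of_real scaleC_scaleC mult.commute)

lemma scaleC_Re_Im: "a *\<^sub>C x = Re a *\<^sub>R x + Im a *\<^sub>R (\<i> *\<^sub>C (x::'a::complex_inner))"
proof -
  have "a *\<^sub>C x = (of_real (Re a) + of_real (Im a) * \<i>) *\<^sub>C x"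
    by (metis complex_eq mult.commute)
  also have "\<dots> = Re a *\<^sub>R x + Im a *\<^sub>R (\<i> *\<^sub>C x)"
    by (simp only: scaleC_add_left scaleC_of_real scaleC_scaleC[symmetric])
  finally show ?thesis .
qed

lemma norm_scaleC: "norm (a *\<^sub>C x) = cmod a * norm (x::'a::complex_inner)"
proof -
  have "complex_of_real ((norm (a *\<^sub>C x))\<^sup>2) = (a * cnj a) * complex_of_real ((norm x)\<^sup>2)"
    using cinner_self[of "a *\<^sub>C x"] cinner_self[of x]
      by (metis cinner_scaleC_left cinner_scaleC_right mult.assoc)
  also have "\<dots> = complex_of_real ((cmod a * norm x)\<^sup>2)"
    by (simp only: complex_norm_square[symmetric] of_real_mult[symmetric] power_mult_distrib)
  finally have "(norm (a *\<^sub>C x))\<^sup>2 = (cmod a * norm x)\<^sup>2"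
    by (simp only: of_real_eq_iff)
  then show ?thesis
    by (simp add: power2_eq_iff_nonneg)
qed

lemma Im_cinner: "Im (cinner x y) = inner x (\<i> *\<^sub>C (y::'a::complex_inner))"
  by (simp add: Re_cinner[symmetric] cinner_simps)

text \<open>The complex form is determined by the real one and multiplication by
  \<open>\<i>\<close>; this later shows that a real-linear isometry respects \<open>cinner\<close>
  up to conjugation once its behaviour on \<open>\<i>\<close> is known.\<close>

lemma cinner_eq_inner: "cinner x y = Complex (inner x y) (inner x (\<i> *\<^sub>C (y::'a::complex_inner)))"
  by (simp add: complex_eq_iff Im_cinner Re_cinner)

lemma clinear_scaleC:
  assumes "clinear A"
  shows "A (c *\<^sub>C x) = c *\<^sub>C A x"
proof -
  interpret A: Vector_Spaces.linear scaleC scaleC A by fact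
  show ?thesis by (rule A.scale)
qed

lemma clinear_imp_linear:
  assumes "clinear A"
  shows "linear A"
proof -
  interpret A: Vector_Spaces.linear scaleC scaleC A by fact
  show ?thesis
    by (intro linearI A.add) (metis A.scale scaleC_of_real)
qed

lemma clinearI:
  assumes "linear A" "\<And>x. A (\<i> *\<^sub>C x) = \<i> *\<^sub>C A x"
  shows "clinear (A :: 'a::complex_inner \<Rightarrow> 'b::complex_inner)"
proof -
  interpret A: linear A by fact
  have "A (c *\<^sub>C x) = c *\<^sub>C A x" for c x
    by (subst (1 2) scaleC_Re_Im) (simp add: A.add A.scale assms(2))
  then show ?thesis
    by unfold_locales (auto simp: A.add scaleC_add_right scaleC_add_left scaleC_scaleC)
qed

text \<open>The rank one operator u v^*. As a bounded real-linear map it lives in a type with an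
  operator norm and a real vector space structure, which the Mazur--Ulam argument requires.\<close>

definition outer :: "'a::{complex_inner,euclidean_space} \<Rightarrow> 'a \<Rightarrow> 'a \<Rightarrow>\<^sub>L 'a"
  where "outer u v = Blinfun (\<lambda>x. cinner x v *\<^sub>C u)"

lemma outer_apply: "blinfun_apply (outer u v) x = cinner x v *\<^sub>C u"
proof -
  have "linear (\<lambda>x. cinner x v *\<^sub>C u)"
    by (intro linearI)
       (simp_all only: cinner_simps scaleC_add_left scaleC_scaleC[symmetric] scaleC_of_real)
  then show ?thesis
    by (simp add: outer_def bounded_linear_Blinfun_apply linear_conv_bounded_linear)
qed

lemma scaleC_sum_right: "a *\<^sub>C sum f A = (\<Sum>i\<in>A. a *\<^sub>C (f i::'a::complex_inner))"
  by (induction A rule: infinite_finite_induct) (simp_all add: scaleC_add_right)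

lemma scaleC_diff_right: "a *\<^sub>C (x - (y::'a::complex_inner)) = a *\<^sub>C x - a *\<^sub>C y"
  by (rule complex_vector.scale_right_diff_distrib)

section \<open>Orthonormal sets, Fourier expansion and Parseval\<close>

definition orthonormal :: "'a::complex_inner set \<Rightarrow> bool"
  where "orthonormal B \<longleftrightarrow> (\<forall>e\<in>B. \<forall>f\<in>B. cinner e f = (if e = f then 1 else 0))"

lemma orthonormalD:
  assumes "orthonormal B" "e \<in> B" "f \<in> B"
  shows "cinner e f = (if e = f then 1 else 0)"
  using assms unfolding orthonormal_def by blast

lemma orthonormal_independent:
  assumes "orthonormal (B :: 'a::{complex_inner,euclidean_space} set)"
  shows "independent B"
proof (rule pairwise_orthogonal_independent)
  show "pairwise orthogonal B"
    using assms by (auto simp: pairwise_def orthogonal_def orthonormal_def Re_cinner[symmetric])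
  show "0 \<notin> B"
    using assms by (auto simp: orthonormal_def dest!: bspec[of _ _ 0])
qed

text \<open>Orthonormal vectors are independent over the reals, so the bound is the real dimension,
  twice the complex one; the slack does no harm below.\<close>

lemma orthonormal_finite:
  assumes "orthonormal (B :: 'a::{complex_inner,euclidean_space} set)"
  shows "finite B" "card B \<le> DIM('a)"
  using independent_bound[OF orthonormal_independent[OF assms]] by auto

lemma cinner_orthonormal_sum:
  assumes "orthonormal (B :: 'a::{complex_inner,euclidean_space} set)" "S \<subseteq> B" "f \<in> B"
  shows "cinner (\<Sum>e\<in>S. c e *\<^sub>C e) f = (if f \<in> S then c f else 0)"
proof -
  have fin: "finite S"
    using orthonormal_finite(1)[OF assms(1)] assms(2) finite_subset by blast
  have "cinner (\<Sum>e\<in>S. c e *\<^sub>C e) f = (\<Sum>e\<in>S. c e * cinner e f)"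
    by (simp add: cinner_sum_left cinner_simps)
  also have "\<dots> = (\<Sum>e\<in>S. if e = f then c e else 0)"
    using assms by (intro sum.cong refl) (auto simp: orthonormalD[OF assms(1)] subset_iff)
  also have "\<dots> = (if f \<in> S then c f else 0)"
    using fin by simp
  finally show ?thesis .
qed

text \<open>Trades the span condition for the Fourier expansion, the form in which bases are used
  from here on. The expansion is checked on basis vectors and propagated by span induction.\<close>

lemma orthonormal_basis_iff:
  "orthonormal_basis (B :: 'a::{complex_inner,euclidean_space} set) \<longleftrightarrow>
    orthonormal B \<and> (\<forall>x. x = (\<Sum>e\<in>B. cinner x e *\<^sub>C e))"
proof (intro iffI conjI allI)
  assume B: "orthonormal_basis B"
  then show on: "orthonormal B"
    by (simp add: orthonormal_basis_def orthonormal_def)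
  fix x
  have "x \<in> complex_vector.span B"
    using B by (simp add: orthonormal_basis_def)
  then show "x = (\<Sum>e\<in>B. cinner x e *\<^sub>C e)"
  proof (induction rule: complex_vector.span_induct_alt)
    case base
    show ?case by simp
  next
    case (step c b y)
    have "(\<Sum>e\<in>B. cinner b e *\<^sub>C e) = (\<Sum>e\<in>B. if e = b then b else 0)"
      using step(1) by (intro sum.cong refl) (auto simp: orthonormalD[OF on])
    also have "\<dots> = b"
      using step(1) orthonormal_finite(1)[OF on] by simp
    finally have b: "(\<Sum>e\<in>B. cinner b e *\<^sub>C e) = b" .
    have "(\<Sum>e\<in>B. cinner (c *\<^sub>C b + y) e *\<^sub>C e) =
        c *\<^sub>C (\<Sum>e\<in>B. cinner b e *\<^sub>C e) + (\<Sum>e\<in>B. cinner y e *\<^sub>C e)"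
      by (simp add: cinner_simps scaleC_add_left scaleC_scaleC sum.distrib scaleC_sum_right)
    with b step(2) show ?case by simp
  qed
next
  assume B: "orthonormal B \<and> (\<forall>x. x = (\<Sum>e\<in>B. cinner x e *\<^sub>C e))"
  have "x \<in> complex_vector.span B" for x
  proof -
    have "(\<Sum>e\<in>B. cinner x e *\<^sub>C e) \<in> complex_vector.span B"
      by (intro complex_vector.span_sum complex_vector.span_scale complex_vector.span_base)
    with B show ?thesis by metis
  qed
  with B show "orthonormal_basis B"
    by (auto simp: orthonormal_basis_def orthonormal_def)
qed

lemma orthonormal_basisD:
  assumes "orthonormal_basis (B :: 'a::{complex_inner,euclidean_space} set)"
  shows "orthonormal B" "finite B" "x = (\<Sum>e\<in>B. cinner x e *\<^sub>C e)"
  using assms orthonormal_finite by (auto simp: orthonormal_basis_iff)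

lemma parseval:
  assumes "orthonormal_basis (B :: 'a::{complex_inner,euclidean_space} set)"
  shows "cinner x y = (\<Sum>e\<in>B. cinner x e * cinner e y)"
    and "(norm x)\<^sup>2 = (\<Sum>e\<in>B. (cmod (cinner x e))\<^sup>2)"
proof -
  show *: "cinner x y = (\<Sum>e\<in>B. cinner x e * cinner e y)" for x y
    by (subst orthonormal_basisD(3)[OF assms, of x]) (simp add: cinner_sum_left cinner_simps)
  have "complex_of_real ((norm x)\<^sup>2) = (\<Sum>e\<in>B. cinner x e * cnj (cinner x e))"
    using *[of x x] by (simp add: cinner_self cinner_commute[of _ x, symmetric])
  also have "\<dots> = of_real (\<Sum>e\<in>B. (cmod (cinner x e))\<^sup>2)"
    by (simp only: complex_norm_square[symmetric] of_real_sum)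
  finally show "(norm x)\<^sup>2 = (\<Sum>e\<in>B. (cmod (cinner x e))\<^sup>2)"
    by (simp only: of_real_eq_iff)
qed

section \<open>The real subspace of Hermitian operators\<close>

definition hermitian_ops :: "('a::{complex_inner,euclidean_space} \<Rightarrow>\<^sub>L 'a) set"
  where "hermitian_ops = {T. \<forall>x y. cinner (blinfun_apply T x) y = cinner x (blinfun_apply T y)}"

lemma hermitianD: "T \<in> hermitian_ops \<Longrightarrow> cinner (blinfun_apply T x) y = cinner x (blinfun_apply T y)"
  by (simp add: hermitian_ops_def)

lemma hermitian_inner: "T \<in> hermitian_ops \<Longrightarrow> inner (blinfun_apply T x) y = inner x (blinfun_apply T y)"
  using hermitianD[of T x y] by (metis Re_cinner)

lemma cinner_left_ext:
  assumes "\<And>z. cinner x z = cinner y z"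
  shows "x = (y::'a::complex_inner)"
proof -
  have "cinner (x - y) (x - y) = 0"
    by (simp add: cinner_diff_left assms)
  then show ?thesis by simp
qed

text \<open>The type guarantees real linearity only. Complex linearity comes from symmetry with
  respect to the full complex form: the scalar is moved through the other argument.\<close>

lemma hermitian_scaleC: "T \<in> hermitian_ops \<Longrightarrow> blinfun_apply T (a *\<^sub>C x) = a *\<^sub>C blinfun_apply T x"
  by (rule cinner_left_ext) (simp add: hermitianD cinner_simps)

lemma hermitian_clinear: "T \<in> hermitian_ops \<Longrightarrow> clinear (blinfun_apply T)"
  by (intro clinearI bounded_linear.linear[OF blinfun.bounded_linear_right]) (rule hermitian_scaleC)

lemma subspace_hermitian: "subspace hermitian_ops"
  by (auto simp: subspace_def hermitian_ops_def blinfun.add_left blinfun.scaleR_left cinner_simps)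

lemma hermitian_add: "S \<in> hermitian_ops \<Longrightarrow> T \<in> hermitian_ops \<Longrightarrow> S + T \<in> hermitian_ops"
  and hermitian_diff: "S \<in> hermitian_ops \<Longrightarrow> T \<in> hermitian_ops \<Longrightarrow> S - T \<in> hermitian_ops"
  and hermitian_scaleR: "S \<in> hermitian_ops \<Longrightarrow> r *\<^sub>R S \<in> hermitian_ops"
  and hermitian_minus: "S \<in> hermitian_ops \<Longrightarrow> - S \<in> hermitian_ops"
  and hermitian_zero: "0 \<in> hermitian_ops"
  and hermitian_sum: "(\<And>i. i \<in> I \<Longrightarrow> F i \<in> hermitian_ops) \<Longrightarrow> sum F I \<in> hermitian_ops"
  by (simp_all add: subspace_add[OF subspace_hermitian] subspace_diff[OF subspace_hermitian]
      subspace_scale[OF subspace_hermitian] subspace_neg[OF subspace_hermitian]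
      subspace_0[OF subspace_hermitian] subspace_sum[OF subspace_hermitian])

lemma hermitian_id: "id_blinfun \<in> hermitian_ops"
  by (simp add: hermitian_ops_def)

lemma hermitian_outer: "outer e e \<in> hermitian_ops"
  by (simp add: hermitian_ops_def outer_apply cinner_simps cinner_commute[of e] mult.commute)

lemma hermitian_outer2: "outer u v + outer v u \<in> hermitian_ops"
  by (simp add: hermitian_ops_def outer_apply cinner_simps blinfun.add_left cinner_commute[of u]
    cinner_commute[of v] algebra_simps)

section \<open>Spectral theorem and functional calculus\<close>

text \<open>If T v were nonzero, passing from v to v - t T v would change the form from 0 to t (t s
  - 2 n), which is negative for small t > 0.\<close>

lemma nonneg_form_zero_imp_kernel:
  fixes T :: "'a::real_inner \<Rightarrow> 'a"
  assumes "subspace V" "linear T" "T ` V \<subseteq> V"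
    and sym: "\<And>x y. inner (T x) y = inner x (T y)"
    and nonneg: "\<And>x. x \<in> V \<Longrightarrow> 0 \<le> inner (T x) x"
    and "v \<in> V" "inner (T v) v = 0"
  shows "T v = 0"
proof (rule ccontr)
  interpret linear T by fact
  define n where "n = inner (T v) (T v)"
  define s where "s = inner (T (T v)) (T v)"
  \<comment> \<open>This choice gives \<open>t * s < n\<close>; the summand 1 covers the case
    \<open>s = 0\<close>.\<close>
  define t where "t = n / (s + 1)"
  assume "T v \<noteq> 0"
  then have n: "n > 0"
    by (simp add: n_def)
  have w: "T v \<in> V"
    using assms by blast
  then have s: "s \<ge> 0"
    using nonneg[of "T v"] by (simp add: s_def)
  have t: "t > 0"
    using n s by (simp add: t_def)
  have "v - t *\<^sub>R T v \<in> V"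
    using assms(1,6) w by (simp add: subspace_diff subspace_scale)
  from nonneg[OF this] have "0 \<le> t * (t * s - 2 * n)"
    using assms(7) sym[of "T v" v]
    by (simp add: diff scale inner_diff_left inner_diff_right n_def s_def algebra_simps inner_commute)
  then have "2 * n \<le> t * s"
    using t by (simp add: zero_le_mult_iff)
  also have "t * s < n"
    using n s by (simp add: t_def field_simps)
  finally show False
    using n by simp
qed

text \<open>At a maximiser v of the form of T on the unit sphere of V, the operator a I - T has a
  nonnegative form on V that vanishes at v. The previous lemma then yields the eigenvector equation
  without differentiation.\<close>

lemma symmetric_eigenvector_exists:
  fixes T :: "'a::euclidean_space \<Rightarrow> 'a"
  assumes V: "subspace V" "V \<noteq> {0}" and T: "linear T" "T ` V \<subseteq> V"
    and sym: "\<And>x y. inner (T x) y = inner x (T y)"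
  obtains v a where "v \<in> V" "norm v = 1" "T v = a *\<^sub>R v"
proof -
  interpret linear T by fact
  let ?K = "V \<inter> sphere 0 1"
  have "compact ?K"
    by (intro closed_Int_compact closed_subspace V compact_sphere)
  moreover have "?K \<noteq> {}"
  proof -
    obtain x where "x \<in> V" "x \<noteq> 0"
      using V subspace_0 by blast
    then have "x /\<^sub>R norm x \<in> ?K"
      using V by (simp add: subspace_scale)
    then show ?thesis by blast
  qed
  moreover have "continuous_on ?K (\<lambda>x. inner (T x) x)"
    by (intro continuous_intros linear_continuous_on linear_conv_bounded_linear[THEN iffD1] T)
  ultimately obtain v where v: "v \<in> ?K" "\<And>x. x \<in> ?K \<Longrightarrow> inner (T x) x \<le> inner (T v) v"
    using continuous_attains_sup[of ?K "\<lambda>x. inner (T x) x"] by blast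
  define a where "a = inner (T v) v"
  define S where "S x = a *\<^sub>R x - T x" for x
  have "S v = 0"
  proof (rule nonneg_form_zero_imp_kernel[of V S v])
    show "linear S"
      by (intro linearI) (simp_all add: S_def add scale algebra_simps)
    show "S ` V \<subseteq> V"
      using V T by (auto simp: S_def image_subset_iff intro!: subspace_diff subspace_scale)
    show "inner (S x) y = inner x (S y)" for x y
      by (simp add: S_def inner_diff_left inner_diff_right sym)
    show "inner (S v) v = 0"
      using v(1) by (simp add: S_def a_def inner_diff_left power2_norm_eq_inner[symmetric])
    show "v \<in> V" using v(1) by simp
    show "subspace V" by fact
    fix x assume x: "x \<in> V"
    show "0 \<le> inner (S x) x"
    proof (cases "x = 0")
      case False
      then have "inner (T (x /\<^sub>R norm x)) (x /\<^sub>R norm x) \<le> a"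
        unfolding a_def using V x by (intro v(2)) (simp add: subspace_scale)
      with False have "inner (T x) x \<le> a * (norm x)\<^sup>2"
        by (simp add: scale field_simps power2_eq_square)
      then show ?thesis
        by (simp add: S_def inner_diff_left power2_norm_eq_inner)
    qed (simp add: S_def zero)
  qed
  then show ?thesis
    using that[of v a] v(1) by (auto simp: S_def)
qed

text \<open>Among the orthonormal sets of eigenvectors containing \<open>B0\<close>, take one of
  largest cardinality. Its orthogonal complement is invariant under T, and an eigenvector there
  would enlarge the set. Prescribing \<open>B0\<close> makes the lemma serve for basis extension as
  well.\<close>

lemma orthonormal_eigenbasis_extension:
  assumes T: "T \<in> hermitian_ops" and B0: "orthonormal B0"
    "\<And>e. e \<in> B0 \<Longrightarrow> \<exists>a::real. blinfun_apply T e = a *\<^sub>R e"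
  obtains B a where "B0 \<subseteq> B" "orthonormal_basis B" "\<And>e. e \<in> B \<Longrightarrow> blinfun_apply T e = a e *\<^sub>R e"
proof -
  define P where "P B \<longleftrightarrow> B0 \<subseteq> B \<and> orthonormal B \<and> (\<forall>e\<in>B. \<exists>a::real. blinfun_apply T e = a *\<^sub>R e)" for B
  have "P B0" using B0 by (simp add: P_def)
  moreover have "\<forall>B. P B \<longrightarrow> card B \<le> DIM('a)"
    by (simp add: P_def orthonormal_finite)
  ultimately obtain B where B: "P B" "\<And>C. P C \<Longrightarrow> card C \<le> card B"
    using ex_has_greatest_nat[of P B0 card] by (metis le_imp_less_Suc)
  then have on: "orthonormal B" by (simp add: P_def)
  define V where "V = {x. \<forall>e\<in>B. cinner x e = 0}"
  have "V = {0}"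
  proof (rule ccontr)
    assume "V \<noteq> {0}"
    moreover have "subspace V"
      by (auto simp: V_def subspace_def cinner_simps)
    moreover have "blinfun_apply T ` V \<subseteq> V"
    proof clarify
      fix x assume x: "x \<in> V"
      have "cinner (blinfun_apply T x) e = 0" if "e \<in> B" for e
      proof -
        have "\<exists>a::real. blinfun_apply T e = a *\<^sub>R e"
          using that B(1) by (simp add: P_def)
        then obtain a :: real where "blinfun_apply T e = a *\<^sub>R e" ..
        then show ?thesis
          using x that by (simp add: hermitianD[OF T] cinner_simps V_def)
      qed
      then show "blinfun_apply T x \<in> V" by (simp add: V_def)
    qed
    moreover have "linear (blinfun_apply T)"
      by (intro bounded_linear.linear[OF blinfun.bounded_linear_right])
    ultimately obtain v a where v: "v \<in> V" "norm v = 1" "blinfun_apply T v = a *\<^sub>R v"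
      using symmetric_eigenvector_exists[of V "blinfun_apply T"] hermitian_inner[OF T] by metis
    have vB: "cinner v e = 0" "cinner e v = 0" if "e \<in> B" for e
      using v(1) that cinner_commute[of e v] by (auto simp: V_def)
    have "cinner v v = 1"
      by (simp add: cinner_self v)
    then have "v \<notin> B" and "orthonormal (insert v B)"
      using vB on by (auto simp: orthonormal_def)
    then have "P (insert v B)"
      using B(1) v(3) by (auto simp: P_def)
    from B(2)[OF this] \<open>v \<notin> B\<close> orthonormal_finite[OF on] show False
      by simp
  qed
  have "x = (\<Sum>e\<in>B. cinner x e *\<^sub>C e)" for x
  proof -
    have "x - (\<Sum>e\<in>B. cinner x e *\<^sub>C e) \<in> V"
      by (auto simp: V_def cinner_diff_left cinner_orthonormal_sum[OF on])
    with \<open>V = {0}\<close> show ?thesis by simp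
  qed
  then have "orthonormal_basis B"
    using on by (simp add: orthonormal_basis_iff)
  moreover obtain a where "\<forall>e\<in>B. blinfun_apply T e = a e *\<^sub>R e"
    using B(1) unfolding P_def by metis
  ultimately show ?thesis
    using that[of B a] B(1) by (auto simp: P_def)
qed

text \<open>Every vector is an eigenvector of the zero operator, so the eigenbasis lemma applies to
  it.\<close>

lemma orthonormal_basis_extension:
  assumes "orthonormal (B0 :: 'a::{complex_inner,euclidean_space} set)"
  obtains B where "B0 \<subseteq> B" "orthonormal_basis B"
proof (rule orthonormal_eigenbasis_extension[OF hermitian_zero assms])
  show "\<exists>a. blinfun_apply 0 e = a *\<^sub>R e" for e :: 'a
    by (rule exI[of _ 0]) simp
qed blast

section \<open>Operators diagonal in an orthonormal basis\<close>

definition diag_op :: "'a::{complex_inner,euclidean_space} set \<Rightarrow> ('a \<Rightarrow> real) \<Rightarrow> 'a \<Rightarrow>\<^sub>L 'a"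
  where "diag_op B a = (\<Sum>e\<in>B. a e *\<^sub>R outer e e)"

lemma diag_op_apply: "blinfun_apply (diag_op B a) x = (\<Sum>e\<in>B. a e *\<^sub>R (cinner x e *\<^sub>C e))"
  by (simp add: diag_op_def blinfun.sum_left blinfun.scaleR_left outer_apply)

lemma diag_op_hermitian: "diag_op B a \<in> hermitian_ops"
  unfolding diag_op_def by (intro hermitian_sum hermitian_scaleR hermitian_outer)

lemma diag_op_eigen:
  assumes "orthonormal B" "e \<in> B"
  shows "blinfun_apply (diag_op B a) e = a e *\<^sub>R e"
proof -
  have "blinfun_apply (diag_op B a) e = (\<Sum>f\<in>B. if f = e then a e *\<^sub>R e else 0)"
    unfolding diag_op_apply using assms by (intro sum.cong refl) (simp add: orthonormalD)
  also have "\<dots> = a e *\<^sub>R e"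
    using assms(2) orthonormal_finite(1)[OF assms(1)] by simp
  finally show ?thesis .
qed

lemma cinner_diag_op:
  assumes "orthonormal B" "e \<in> B"
  shows "cinner (blinfun_apply (diag_op B a) x) e = of_real (a e) * cinner x e"
  by (simp add: hermitianD[OF diag_op_hermitian] diag_op_eigen[OF assms] cinner_simps)

lemma diag_op_const:
  assumes "orthonormal_basis B"
  shows "diag_op B (\<lambda>_. c) = c *\<^sub>R id_blinfun"
  by (rule blinfun_eqI)
     (simp add: diag_op_apply blinfun.scaleR_left scaleR_sum_right[symmetric]
        orthonormal_basisD(3)[OF assms, symmetric])

lemma spectral_decomposition:
  assumes "T \<in> hermitian_ops"
  obtains B a where "orthonormal_basis B" "T = diag_op B a"
proof -
  obtain B a where B: "orthonormal_basis B" "\<And>e. e \<in> B \<Longrightarrow> blinfun_apply T e = a e *\<^sub>R e"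
    using orthonormal_eigenbasis_extension[OF assms, of "{}"] by (auto simp: orthonormal_def)
  have "T = diag_op B a"
  proof (rule blinfun_eqI)
    fix x
    have "blinfun_apply T x = (\<Sum>e\<in>B. cinner (blinfun_apply T x) e *\<^sub>C e)"
      by (rule orthonormal_basisD(3)[OF B(1)])
    also have "\<dots> = blinfun_apply (diag_op B a) x"
      unfolding diag_op_apply
      by (intro sum.cong refl)
         (simp add: hermitianD[OF assms] B(2) cinner_simps scaleC_scaleC[symmetric] scaleC_of_real
           del: complex_vector.scale_scale)
    finally show "blinfun_apply T x = blinfun_apply (diag_op B a) x" .
  qed
  with B that show ?thesis by blast
qed

lemma orthonormal_basis_ext:
  assumes "orthonormal_basis (B :: 'a::{complex_inner,euclidean_space} set)"
    "\<And>e. e \<in> B \<Longrightarrow> cinner x e = cinner y e"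
  shows "x = y"
proof -
  have "(\<Sum>e\<in>B. cinner x e *\<^sub>C e) = (\<Sum>e\<in>B. cinner y e *\<^sub>C e)"
    using assms(2) by simp
  then show ?thesis
    using orthonormal_basisD(3)[OF assms(1)] by metis
qed

lemma orthogonal_projection_eqI:
  fixes x y :: "'a::complex_inner"
  assumes "\<And>u v. u \<in> S \<Longrightarrow> v \<in> S \<Longrightarrow> u - v \<in> S" "y \<in> S" "\<And>z. z \<in> S \<Longrightarrow> cinner (x - y) z = 0"
  shows "orthogonal_projection S x = y"
  unfolding orthogonal_projection_def
proof (rule the_equality)
  fix u assume u: "u \<in> S \<and> (\<forall>z\<in>S. cinner (x - u) z = 0)"
  then have "u - y \<in> S" using assms by blast
  then have "cinner ((x - y) - (x - u)) (u - y) = 0"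
    using u assms(3) by (metis cinner_diff_left diff_zero)
  then show "u = y" by simp
qed (use assms in auto)

text \<open>The projection onto the eigenspace of t collects the basis vectors with
  \<open>a e = t\<close>, and grouping the sum over the basis by eigenvalue takes care of
  multiplicities. From here on the functional calculus can be computed in any eigenbasis.\<close>

lemma functional_calculus_diag_op:
  fixes B :: "'a::{complex_inner,euclidean_space} set"
  assumes B: "orthonormal_basis B"
  shows "functional_calculus f (blinfun_apply (diag_op B a)) = blinfun_apply (diag_op B (\<lambda>e. f (a
    e)))"
proof
  fix x
  let ?T = "blinfun_apply (diag_op B a)"
  note on = orthonormal_basisD(1)[OF B]
  \<comment> \<open>In coordinates, the eigenvalue equation for t says that the components along all
    e with \<open>a e \<noteq> t\<close> vanish.\<close>
  have eig: "?T x = complex_of_real t *\<^sub>C x \<longleftrightarrow> (\<forall>e\<in>B. a e \<noteq> t \<longrightarrow> cinner x e = 0)" for x t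
  proof -
    have "?T x = complex_of_real t *\<^sub>C x \<longleftrightarrow> (\<forall>e\<in>B. cinner (?T x) e = cinner (complex_of_real t *\<^sub>C x)
      e)"
      using orthonormal_basis_ext[OF B] by metis
    also have "\<dots> \<longleftrightarrow> (\<forall>e\<in>B. a e \<noteq> t \<longrightarrow> cinner x e = 0)"
      by (auto simp: cinner_diag_op[OF on] cinner_simps)
    finally show ?thesis .
  qed
  have spectrum: "real_eigenvalues ?T = a ` B"
  proof (intro equalityI subsetI)
    fix t assume "t \<in> real_eigenvalues ?T"
    then obtain x where x: "x \<noteq> 0" "\<forall>e\<in>B. a e \<noteq> t \<longrightarrow> cinner x e = 0"
      by (auto simp: real_eigenvalues_def eig)
    obtain e where "e \<in> B" "cinner x e \<noteq> 0"
      using x(1) orthonormal_basis_ext[OF B, of x 0] by auto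
    with x show "t \<in> a ` B" by auto
  next
    fix t assume "t \<in> a ` B"
    then obtain e where e: "e \<in> B" "t = a e" by blast
    then have "e \<noteq> 0" using orthonormalD[OF on, of e e] by auto
    with e show "t \<in> real_eigenvalues ?T"
      by (auto simp: real_eigenvalues_def diag_op_eigen[OF on] scaleC_of_real)
  qed
  have proj: "orthogonal_projection (eigenspace ?T t) x = (\<Sum>e | e \<in> B \<and> a e = t. cinner x e *\<^sub>C e)"
    for t
  proof (rule orthogonal_projection_eqI)
    let ?y = "\<Sum>e | e \<in> B \<and> a e = t. cinner x e *\<^sub>C e"
    have y: "cinner ?y e = (if a e = t then cinner x e else 0)" if "e \<in> B" for e
      using that by (subst cinner_orthonormal_sum[OF on]) auto
    then show "?y \<in> eigenspace ?T t"
      by (auto simp: eigenspace_def eig)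
    show "u - v \<in> eigenspace ?T t" if "u \<in> eigenspace ?T t" "v \<in> eigenspace ?T t" for u v
      using that by (auto simp: eigenspace_def eig cinner_diff_left)
    fix z assume "z \<in> eigenspace ?T t"
    then have z: "cinner e z = 0" if "e \<in> B" "a e \<noteq> t" for e
      using that cinner_commute[of e z] by (auto simp: eigenspace_def eig)
    show "cinner (x - ?y) z = 0"
      unfolding parseval(1)[OF B, of "x - ?y" z]
      using y z by (intro sum.neutral) (auto simp: cinner_diff_left)
  qed
  have "functional_calculus f ?T x =
      (\<Sum>t\<in>a ` B. \<Sum>e | e \<in> B \<and> a e = t. f (a e) *\<^sub>R (cinner x e *\<^sub>C e))"
    by (simp add: functional_calculus_def spectrum proj scaleR_sum_right)
  also have "\<dots> = (\<Sum>e\<in>B. f (a e) *\<^sub>R (cinner x e *\<^sub>C e))"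
    using orthonormal_basisD(2)[OF B] by (rule sum.image_gen[symmetric])
  finally show "functional_calculus f ?T x = blinfun_apply (diag_op B (\<lambda>e. f (a e))) x"
    by (simp add: diag_op_apply)
qed

text \<open>The trace is taken in an unknown basis \<open>C\<close> picked by choice. Interchanging
  the sums and applying Parseval in \<open>C\<close> makes the choice disappear.\<close>

lemma op_trace_diag_op:
  assumes B: "orthonormal_basis (B :: 'a::{complex_inner,euclidean_space} set)"
  shows "op_trace (blinfun_apply (diag_op B a)) = of_real (\<Sum>e\<in>B. a e)"
proof -
  define C :: "'a set" where "C = (SOME B. orthonormal_basis B)"
  have C: "orthonormal_basis C"
    unfolding C_def using B by (rule someI)
  have "op_trace (blinfun_apply (diag_op B a)) = (\<Sum>c\<in>C. \<Sum>e\<in>B. of_real (a e) * (cinner c e * cinner e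
    c))"
    unfolding op_trace_def C_def[symmetric]
    by (simp add: diag_op_apply cinner_sum_left cinner_simps)
  also have "\<dots> = (\<Sum>e\<in>B. of_real (a e) * (\<Sum>c\<in>C. cinner e c * cinner c e))"
    by (subst sum.swap) (simp add: sum_distrib_left mult.commute)
  also have "\<dots> = (\<Sum>e\<in>B. of_real (a e))"
    by (intro sum.cong refl)
       (simp add: parseval(1)[OF C, symmetric] orthonormalD[OF orthonormal_basisD(1)[OF B]])
  finally show ?thesis by simp
qed

lemma diag_op_mult:
  assumes "orthonormal_basis B"
  shows "blinfun_apply (diag_op B a) (blinfun_apply (diag_op B b) x) = blinfun_apply (diag_op B (\<lambda>e.
    a e * b e)) x"
  by (rule orthonormal_basis_ext[OF assms]) (simp
    add: cinner_diag_op[OF orthonormal_basisD(1)[OF assms]])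

lemma diag_op_cong:
  assumes "\<And>e. e \<in> B \<Longrightarrow> a e = b e"
  shows "diag_op B a = diag_op B b"
  unfolding diag_op_def using assms by (intro sum.cong) auto

lemma cinner_diag_op_self:
  "cinner (blinfun_apply (diag_op B a) x) x = of_real (\<Sum>e\<in>B. a e * (cmod (cinner x e))\<^sup>2)"
proof -
  have "cinner (blinfun_apply (diag_op B a) x) x = (\<Sum>e\<in>B. of_real (a e) * (cinner x e * cnj (cinner
    x e)))"
    by (simp add: diag_op_apply cinner_sum_left cinner_simps cinner_commute[of _ x, symmetric])
  then show ?thesis
    by (simp only: complex_norm_square[symmetric] of_real_mult[symmetric] of_real_sum)
qed

lemma diag_op_add: "diag_op B a + diag_op B b = diag_op B (\<lambda>e. a e + b e)"
  by (simp add: diag_op_def scaleR_add_left sum.distrib)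

lemma diag_op_diff: "diag_op B a - diag_op B b = diag_op B (\<lambda>e. a e - b e)"
  by (simp add: diag_op_def scaleR_diff_left sum_subtractf)

lemma diag_op_scaleR: "r *\<^sub>R diag_op B a = diag_op B (\<lambda>e. r * a e)"
  by (simp add: diag_op_def scaleR_sum_right)

lemma cmod_cinner_commute: "cmod (cinner x y) = cmod (cinner y (x::'a::complex_inner))"
  by (metis cinner_commute complex_mod_cnj)

section \<open>Positive definite operators as positive diagonal operators\<close>

lemma diag_op_positive_definite:
  assumes B: "orthonormal_basis B" and pos: "\<And>e. e \<in> B \<Longrightarrow> a e > 0"
  shows "blinfun_apply (diag_op B a) \<in> positive_definite_ops"
proof -
  have inv: "blinfun_apply (diag_op B (\<lambda>e. c e * d e)) x = x" if
    "\<And>e. e \<in> B \<Longrightarrow> c e * d e = 1" for c d :: "'a \<Rightarrow> real" and x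
    using diag_op_cong[of B "\<lambda>e. c e * d e" "\<lambda>_. 1"] that by (simp add: diag_op_const[OF B])
  have "bij (blinfun_apply (diag_op B a))"
  proof (rule o_bij)
    show "blinfun_apply (diag_op B (\<lambda>e. inverse (a e))) \<circ> blinfun_apply (diag_op B a) = id"
      using pos by (auto simp: fun_eq_iff diag_op_mult[OF B] less_imp_neq
        intro!: inv left_inverse dest: pos)
    show "blinfun_apply (diag_op B a) \<circ> blinfun_apply (diag_op B (\<lambda>e. inverse (a e))) = id"
      using pos by (auto simp: fun_eq_iff diag_op_mult[OF B] less_imp_neq
        intro!: inv right_inverse dest: pos)
  qed
  moreover have "cinner (blinfun_apply (diag_op B a) x) x \<in> \<real>\<^sub>\<ge>\<^sub>0" for x
    unfolding cinner_diag_op_self using pos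
    by (simp add: less_imp_le sum_nonneg del: of_real_sum)
  ultimately show ?thesis
    by (simp add: positive_definite_ops_def positive_semidefinite_def hermitian_clinear
      diag_op_hermitian)
qed

text \<open>Polarisation: the defect \<open>h\<close> vanishes on the diagonal; testing it on x + y
  makes it antisymmetric, testing it on x + \<open>\<i>\<close> y makes it symmetric, so it is
  zero.\<close>

lemma clinear_real_form_symmetric:
  assumes A: "clinear (A :: 'a::complex_inner \<Rightarrow> 'a)" and real: "\<And>x. cinner (A x) x \<in> \<real>"
  shows "cinner (A x) y = cinner x (A y)"
proof -
  interpret A: Vector_Spaces.linear scaleC scaleC A by fact
  define h where "h x y = cinner (A x) y - cinner x (A y)" for x y
  have h0: "h x x = 0" for x
    using real[of x] cinner_commute[of x "A x"] by (simp add: h_def Reals_cnj_iff)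
  have "h x y + h y x = 0"
    using h0[of "x + y"] h0[of x] h0[of y] by (simp add: h_def A.add cinner_simps algebra_simps)
  moreover have "- \<i> * h x y + \<i> * h y x = 0"
    using h0[of "x + \<i> *\<^sub>C y"] h0[of x] h0[of y]
    by (simp add: h_def A.add A.scale cinner_simps algebra_simps)
  ultimately have "2 * h x y = 0"
    by (auto simp: add_eq_0_iff)
  then have "h x y = 0" by simp
  then show ?thesis by (simp add: h_def)
qed

text \<open>A real form makes the operator Hermitian, so the spectral theorem applies; nonnegativity
  and injectivity then rule out negative and zero eigenvalues.\<close>

lemma positive_definite_decomposition:
  fixes A :: "'a::{complex_inner,euclidean_space} \<Rightarrow> 'a"
  assumes A: "A \<in> positive_definite_ops"
  obtains B a where "orthonormal_basis B" "A = blinfun_apply (diag_op B a)" "\<And>e. e \<in> B \<Longrightarrow> a e > 0"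
proof -
  have lin: "clinear A" and nonneg: "\<And>x. cinner (A x) x \<in> \<real>\<^sub>\<ge>\<^sub>0" and bij: "bij A"
    using A by (auto simp: positive_definite_ops_def positive_semidefinite_def)
  have T: "blinfun_apply (Blinfun A) = A"
    using clinear_imp_linear[OF lin]
      by (simp add: bounded_linear_Blinfun_apply linear_conv_bounded_linear)
  have "Blinfun A \<in> hermitian_ops"
    using clinear_real_form_symmetric[OF lin] nonneg nonneg_Reals_subset_Reals
    by (simp add: hermitian_ops_def T) blast
  then obtain B a where B: "orthonormal_basis B" "Blinfun A = diag_op B a"
    by (rule spectral_decomposition)
  note on = orthonormal_basisD(1)[OF B(1)]
  have "a e > 0" if e: "e \<in> B" for e
  proof -
    have Ae: "A e = a e *\<^sub>R e"
      using diag_op_eigen[OF on e] B(2) T by metis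
    have ee: "cinner e e = 1"
      using orthonormalD[OF on e e] by simp
    have "a e \<ge> 0"
      using nonneg[of e] by (simp add: Ae cinner_simps ee complex_nonneg_Reals_iff)
    moreover have "a e \<noteq> 0"
    proof
      assume "a e = 0"
      then have "A e = A 0"
        using Ae clinear_scaleC[OF lin, of 0 0] by simp
      then have "e = 0" using bij by (metis bij_pointE)
      with ee show False by simp
    qed
    ultimately show ?thesis by simp
  qed
  with B T that show ?thesis by metis
qed

section \<open>Logarithms and the trace of the exponential\<close>

text \<open>The logarithm repackaged as a bounded linear map, so that logarithms lie in the normed
  space on which the isometry argument runs.\<close>

definition log_op :: "('a::{complex_inner,euclidean_space} \<Rightarrow> 'a) \<Rightarrow> 'a \<Rightarrow>\<^sub>L 'a"
  where "log_op A = Blinfun (op_log A)"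

definition tr_exp :: "'a::{complex_inner,euclidean_space} \<Rightarrow>\<^sub>L 'a \<Rightarrow> real"
  where "tr_exp X = Re (op_trace (op_exp (blinfun_apply X)))"

lemma log_op_diag_op:
  assumes "orthonormal_basis B"
  shows "log_op (blinfun_apply (diag_op B a)) = diag_op B (\<lambda>e. ln (a e))"
  by (simp add: log_op_def functional_calculus_diag_op[OF assms] blinfun_apply_inverse)

lemma log_op:
  assumes "A \<in> positive_definite_ops"
  shows log_op_hermitian: "log_op A \<in> hermitian_ops" and log_op_apply: "blinfun_apply (log_op A) =
    op_log A"
    and op_exp_log_op: "op_exp (blinfun_apply (log_op A)) = A"
proof -
  obtain B a where B: "orthonormal_basis B" "A = blinfun_apply (diag_op B a)" "\<And>e. e \<in> B \<Longrightarrow> a e > 0"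
    using positive_definite_decomposition[OF assms] by metis
  show "log_op A \<in> hermitian_ops"
    by (simp add: B(2) log_op_diag_op[OF B(1)] diag_op_hermitian)
  show "blinfun_apply (log_op A) = op_log A"
    by (simp add: B(2) log_op_diag_op[OF B(1)] functional_calculus_diag_op[OF B(1)])
  have "diag_op B (\<lambda>e. exp (ln (a e))) = diag_op B a"
    using B(3) by (intro diag_op_cong) simp
  then show "op_exp (blinfun_apply (log_op A)) = A"
    by (simp add: B(2) log_op_diag_op[OF B(1)] functional_calculus_diag_op[OF B(1)])
qed

lemma op_exp_hermitian:
  assumes "X \<in> hermitian_ops"
  shows op_exp_positive_definite: "op_exp (blinfun_apply X) \<in> positive_definite_ops"
    and log_op_op_exp: "log_op (op_exp (blinfun_apply X)) = X"
proof -
  obtain B a where B: "orthonormal_basis B" "X = diag_op B a"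
    using spectral_decomposition[OF assms] .
  show "op_exp (blinfun_apply X) \<in> positive_definite_ops"
    by (simp add: B(2) functional_calculus_diag_op[OF B(1)] diag_op_positive_definite[OF B(1)])
  show "log_op (op_exp (blinfun_apply X)) = X"
    by (simp add: B(2) functional_calculus_diag_op[OF B(1)] log_op_diag_op[OF B(1)])
qed

text \<open>Writing Tr A as the trace of the exponential of log A leaves only values of
  \<open>tr_exp\<close>.\<close>

lemma renyi_flat_log_op:
  assumes "A \<in> positive_definite_ops" "B \<in> positive_definite_ops"
  shows "renyi_flat \<alpha> A B = inverse (\<alpha> - 1) *
    ln (inverse (tr_exp (log_op A)) * tr_exp (\<alpha> *\<^sub>R log_op A + (1 - \<alpha>) *\<^sub>R log_op B))"
proof -
  have "blinfun_apply (\<alpha> *\<^sub>R log_op A + (1 - \<alpha>) *\<^sub>R log_op B) =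
      (\<lambda>x. \<alpha> *\<^sub>R op_log A x + (1 - \<alpha>) *\<^sub>R op_log B x)"
    using assms by (simp add: fun_eq_iff blinfun.add_left blinfun.scaleR_left log_op_apply)
  then show ?thesis
    using assms by (simp add: renyi_flat_def tr_exp_def op_exp_log_op)
qed

section \<open>Convexity and order estimates for the trace of the exponential\<close>

lemma tr_exp_diag_op:
  assumes "orthonormal_basis B"
  shows "tr_exp (diag_op B a) = (\<Sum>e\<in>B. exp (a e))"
  by (simp add: tr_exp_def functional_calculus_diag_op[OF assms] op_trace_diag_op[OF assms]
    del: of_real_sum)

lemma tr_exp_pos:
  assumes "X \<in> hermitian_ops"
  shows "tr_exp (X :: 'a::{complex_inner,euclidean_space} \<Rightarrow>\<^sub>L 'a) > 0"
proof -
  obtain B a where B: "orthonormal_basis B" "X = diag_op B a"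
    using spectral_decomposition[OF assms] .
  obtain b :: 'a where "b \<in> Basis" using nonempty_Basis by blast
  then have "b \<noteq> 0" by (rule nonzero_Basis)
  then have "B \<noteq> {}"
    using orthonormal_basisD(3)[OF B(1), of b] by auto
  then show ?thesis
    using orthonormal_basisD(2)[OF B(1)] by (simp add: B(2) tr_exp_diag_op[OF B(1)] sum_pos)
qed

text \<open>Each diagonal entry of X in \<open>C\<close> is an average of the eigenvalues of X with
  weights the squared moduli of the overlaps. Jensen's inequality for \<open>exp\<close> applies to
  each entry, and summing over \<open>C\<close> restores weight one to every eigenvalue.\<close>

lemma peierls_inequality:
  assumes C: "orthonormal_basis C" and X: "X \<in> hermitian_ops"
  shows "(\<Sum>c\<in>C. exp (inner (blinfun_apply X c) c)) \<le> tr_exp X"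
proof -
  obtain B a where B: "orthonormal_basis B" "X = diag_op B a"
    using spectral_decomposition[OF X] .
  have one: "(\<Sum>f\<in>D. (cmod (cinner e f))\<^sup>2) = 1"
    if "orthonormal_basis D" "orthonormal_basis E" "e \<in> E" for D E :: "'a set" and e
  proof -
    have "cinner e e = 1"
      using orthonormalD[OF orthonormal_basisD(1)[OF that(2)] that(3,3)] by simp
    then have "(norm e)\<^sup>2 = 1"
      by (metis cinner_self of_real_eq_1_iff)
    then show ?thesis using parseval(2)[OF that(1), of e] by simp
  qed
  have "(\<Sum>c\<in>C. exp (inner (blinfun_apply X c) c)) = (\<Sum>c\<in>C. exp (\<Sum>e\<in>B. (cmod (cinner c e))\<^sup>2 *\<^sub>R a e))"
    by (simp add: B(2) Re_cinner[symmetric] cinner_diag_op_self mult.commute del: of_real_sum)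
  also have "\<dots> \<le> (\<Sum>c\<in>C. \<Sum>e\<in>B. (cmod (cinner c e))\<^sup>2 * exp (a e))"
  proof (rule sum_mono)
    fix c assume c: "c \<in> C"
    then have "B \<noteq> {}"
      using one[OF B(1) C c] by auto
    then show "exp (\<Sum>e\<in>B. (cmod (cinner c e))\<^sup>2 *\<^sub>R a e) \<le> (\<Sum>e\<in>B. (cmod (cinner c e))\<^sup>2 * exp (a e))"
      using one[OF B(1) C c] orthonormal_basisD(2)[OF B(1)]
      by (intro convex_on_sum[OF _ _ exp_convex]) auto
  qed
  also have "\<dots> = (\<Sum>e\<in>B. exp (a e) * (\<Sum>c\<in>C. (cmod (cinner e c))\<^sup>2))"
    by (subst sum.swap) (simp add: sum_distrib_left mult.commute cmod_cinner_commute)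
  also have "\<dots> = tr_exp X"
    using one[OF C B(1)] by (simp add: B(2) tr_exp_diag_op[OF B(1)])
  finally show ?thesis .
qed

text \<open>Complete x to an orthonormal basis and keep one term of the Peierls sum.\<close>

lemma tr_exp_ge_exp_form:
  assumes "X \<in> hermitian_ops" "norm x = 1"
  shows "exp (inner (blinfun_apply X x) x) \<le> tr_exp X"
proof -
  have "orthonormal {x}"
    using assms(2) by (simp add: orthonormal_def cinner_self)
  then obtain C where C: "{x} \<subseteq> C" "orthonormal_basis C"
    by (rule orthonormal_basis_extension)
  then have "exp (inner (blinfun_apply X x) x) \<le> (\<Sum>c\<in>C. exp (inner (blinfun_apply X c) c))"
    using orthonormal_basisD(2) by (intro member_le_sum) auto
  also have "\<dots> \<le> tr_exp X"
    by (rule peierls_inequality[OF C(2) assms(1)])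
  finally show ?thesis .
qed

text \<open>In an eigenbasis of X the Peierls inequality for X is an equality; the entries are
  compared one by one and Peierls is applied to Y. This avoids operator monotonicity, which fails
  for the exponential.\<close>

lemma tr_exp_mono:
  assumes "X \<in> hermitian_ops" "Y \<in> hermitian_ops"
    "\<And>x. inner (blinfun_apply X x) x \<le> inner (blinfun_apply Y x) x"
  shows "tr_exp X \<le> tr_exp Y"
proof -
  obtain B a where B: "orthonormal_basis B" "X = diag_op B a"
    using spectral_decomposition[OF assms(1)] .
  note on = orthonormal_basisD(1)[OF B(1)]
  have "tr_exp X = (\<Sum>e\<in>B. exp (inner (blinfun_apply X e) e))"
    unfolding B(2) tr_exp_diag_op[OF B(1)]
    by (intro sum.cong refl) (simp add: diag_op_eigen[OF on] Re_cinner[symmetric]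
      orthonormalD[OF on] cinner_simps)
  also have "\<dots> \<le> (\<Sum>e\<in>B. exp (inner (blinfun_apply Y e) e))"
    by (intro sum_mono) (simp add: assms(3))
  also have "\<dots> \<le> tr_exp Y"
    by (rule peierls_inequality[OF B(1) assms(2)])
  finally show ?thesis .
qed

lemma tr_exp_add_scalar:
  assumes "X \<in> hermitian_ops"
  shows "tr_exp (X + c *\<^sub>R id_blinfun) = exp c * tr_exp X"
proof -
  obtain B a where B: "orthonormal_basis B" "X = diag_op B a"
    using spectral_decomposition[OF assms] .
  have "X + c *\<^sub>R id_blinfun = diag_op B (\<lambda>e. a e + c)"
    by (simp add: B(2) diag_op_const[OF B(1), symmetric] diag_op_add)
  then show ?thesis
    by (simp add: B(2) tr_exp_diag_op[OF B(1)] exp_add sum_distrib_left mult.commute)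
qed

text \<open>The operator inequality D \<le> c I. Nonnegativity of D is written
  \<open>form_le (- D) 0\<close>, so one predicate carries the whole order structure.\<close>

definition form_le :: "'a::{complex_inner,euclidean_space} \<Rightarrow>\<^sub>L 'a \<Rightarrow> real \<Rightarrow> bool"
  where "form_le D c \<longleftrightarrow> (\<forall>x. inner (blinfun_apply D x) x \<le> c * (norm x)\<^sup>2)"

lemma form_leI_unit:
  assumes "\<And>x. norm x = 1 \<Longrightarrow> inner (blinfun_apply D x) x \<le> c"
  shows "form_le D c"
  unfolding form_le_def
proof
  fix x
  show "inner (blinfun_apply D x) x \<le> c * (norm x)\<^sup>2"
  proof (cases "x = 0")
    case False
    then have "inner (blinfun_apply D (x /\<^sub>R norm x)) (x /\<^sub>R norm x) \<le> c"
      by (intro assms) simp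
    with False show ?thesis
      by (simp add: blinfun.scaleR_right field_simps power2_eq_square)
  qed simp
qed

text \<open>The operator has eigenvalue 0 at x and -n on the orthogonal complement of x, so for
  large n only the direction x contributes to the trace.\<close>

lemma tr_exp_outer_le:
  assumes "norm x = 1"
  shows "tr_exp (real n *\<^sub>R (outer x x - id_blinfun :: 'a::{complex_inner,euclidean_space} \<Rightarrow>\<^sub>L 'a))
      \<le> 1 + DIM('a) * exp (- real n)"
proof -
  have "orthonormal {x}"
    using assms by (simp add: orthonormal_def cinner_self)
  then obtain C where C: "{x} \<subseteq> C" "orthonormal_basis C"
    by (rule orthonormal_basis_extension)
  note fin = orthonormal_basisD(2)[OF C(2)]
  have "outer x x = diag_op C (\<lambda>e. if e = x then 1 else 0)"
  proof -
    have "diag_op C (\<lambda>e. if e = x then 1 else 0) = (\<Sum>e\<in>C. if e = x then outer x x else 0)"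
      unfolding diag_op_def by (intro sum.cong) auto
    then show ?thesis using C(1) fin by simp
  qed
  then have "real n *\<^sub>R (outer x x - id_blinfun) = diag_op C (\<lambda>e. if e = x then 0 else - real n)"
    by (simp add: scaleR_diff_right diag_op_const[OF C(2), symmetric] diag_op_scaleR diag_op_diff)
       (auto intro!: diag_op_cong)
  then have "tr_exp (real n *\<^sub>R (outer x x - id_blinfun)) = (\<Sum>e\<in>C. exp (if e = x then 0 else - real
    n))"
    by (simp add: tr_exp_diag_op[OF C(2)])
  also have "\<dots> \<le> (\<Sum>e\<in>C. (if e = x then 1 else 0) + exp (- real n))"
    by (intro sum_mono) auto
  also have "\<dots> = 1 + card C * exp (- real n)"
    using C(1) fin by (simp add: sum.distrib)
  also have "\<dots> \<le> 1 + DIM('a) * exp (- real n)"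
    using orthonormal_finite(2)[OF orthonormal_basisD(1)[OF C(2)]] by simp
  finally show ?thesis .
qed

lemma one_plus_exp_limit: "(\<lambda>n. c * (1 + d * exp (- real n))) \<longlonglongrightarrow> c"
proof -
  have "(\<lambda>n. exp (- real n)) \<longlonglongrightarrow> 0"
    by (intro filterlim_compose[OF exp_at_bot]
      filterlim_uminus_at_bot_at_top[THEN filterlim_compose] filterlim_real_sequentially)
  then have "(\<lambda>n. c * (1 + d * exp (- real n))) \<longlonglongrightarrow> c * (1 + d * 0)"
    by (intro tendsto_intros)
  then show ?thesis by simp
qed

text \<open>One direction is monotonicity against a scalar shift. In the other, the test operators
  \<open>Z n\<close> annihilate x, so the form of \<open>Z n + D\<close> at x is that of D, while
  the trace of the exponential of \<open>Z n\<close> is at most a quantity tending to 1.\<close>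

lemma form_le_iff_tr_exp:
  assumes D: "D \<in> hermitian_ops"
  shows "form_le D c \<longleftrightarrow> (\<forall>Z\<in>hermitian_ops. tr_exp (Z + D) \<le> exp c * tr_exp Z)"
proof
  assume "form_le D c"
  then have "tr_exp (Z + D) \<le> tr_exp (Z + c *\<^sub>R id_blinfun)" if "Z \<in> hermitian_ops" for Z
    using that D unfolding form_le_def
    by (intro tr_exp_mono hermitian_add hermitian_scaleR hermitian_id)
       (auto simp: blinfun.add_left blinfun.scaleR_left inner_add_left power2_norm_eq_inner)
  then show "\<forall>Z\<in>hermitian_ops. tr_exp (Z + D) \<le> exp c * tr_exp Z"
    by (simp add: tr_exp_add_scalar)
next
  assume *: "\<forall>Z\<in>hermitian_ops. tr_exp (Z + D) \<le> exp c * tr_exp Z"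
  show "form_le D c"
  proof (rule form_leI_unit)
    fix x :: 'a assume x: "norm x = 1"
    define Z :: "nat \<Rightarrow> 'a \<Rightarrow>\<^sub>L 'a" where "Z n = real n *\<^sub>R (outer x x - id_blinfun)" for n
    have Z: "Z n \<in> hermitian_ops" for n
      by (simp add: Z_def hermitian_scaleR hermitian_diff hermitian_outer hermitian_id)
    have "exp (inner (blinfun_apply D x) x) \<le> exp c * (1 + DIM('a) * exp (- real n))" for n
    proof -
      have "blinfun_apply (Z n) x = 0"
        using x by (simp add: Z_def blinfun.scaleR_left blinfun.diff_left outer_apply cinner_self)
      then have "exp (inner (blinfun_apply D x) x) = exp (inner (blinfun_apply (Z n + D) x) x)"
        by (simp add: blinfun.add_left)
      also have "\<dots> \<le> tr_exp (Z n + D)"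
        by (rule tr_exp_ge_exp_form[OF hermitian_add[OF Z D] x])
      also have "\<dots> \<le> exp c * tr_exp (Z n)"
        using * Z by blast
      also have "\<dots> \<le> exp c * (1 + DIM('a) * exp (- real n))"
        unfolding Z_def by (intro mult_left_mono tr_exp_outer_le x) simp
      finally show ?thesis .
    qed
    then have "exp (inner (blinfun_apply D x) x) \<le> exp c"
      by (intro LIMSEQ_le_const[OF one_plus_exp_limit]) blast
    then show "inner (blinfun_apply D x) x \<le> c"
      by simp
  qed
qed

section \<open>The Mazur--Ulam theorem\<close>

text \<open>The carrier is a set because the Hermitian operators form a subspace and not a type;
  inverses are accordingly taken with \<open>inv_into S\<close>.\<close>

definition isometry_group :: "'v::real_normed_vector set \<Rightarrow> ('v \<Rightarrow> 'v) set"
  where "isometry_group S = {f. bij_betw f S S \<and> (\<forall>x\<in>S. \<forall>y\<in>S. dist (f x) (f y) = dist x y)}"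

lemma isometry_group_comp:
  "f \<in> isometry_group S \<Longrightarrow> g \<in> isometry_group S \<Longrightarrow> g \<circ> f \<in> isometry_group S"
  by (auto simp: isometry_group_def bij_betw_trans bij_betw_apply)

lemma isometry_group_inv:
  assumes "f \<in> isometry_group S"
  shows "inv_into S f \<in> isometry_group S"
proof -
  have bij: "bij_betw f S S"
    using assms by (simp add: isometry_group_def)
  have "dist (inv_into S f x) (inv_into S f y) = dist x y" if "x \<in> S" "y \<in> S" for x y
  proof -
    have "inv_into S f x \<in> S" "inv_into S f y \<in> S"
      using bij_betw_inv_into[OF bij] that by (auto simp: bij_betw_apply)
    then have "dist (f (inv_into S f x)) (f (inv_into S f y)) = dist (inv_into S f x) (inv_into S f
      y)"
      using assms by (simp add: isometry_group_def)
    then show ?thesis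
      using that by (simp add: bij_betw_inv_into_right[OF bij])
  qed
  then show ?thesis
    by (simp add: isometry_group_def bij_betw_inv_into[OF bij])
qed

lemma reflection_isometry_group:
  assumes "subspace S" "a \<in> S" "b \<in> S"
  shows "(\<lambda>x. a + b - x) \<in> isometry_group S"
proof -
  have "bij_betw (\<lambda>x. a + b - x) S S"
    by (rule bij_betw_byWitness[where f' = "\<lambda>x. a + b - x"])
       (use assms in \<open>auto intro!: subspace_diff subspace_add\<close>)
  then show ?thesis
    by (simp add: isometry_group_def dist_norm norm_minus_commute)
qed

text \<open>Vaisala's proof of the Mazur--Ulam theorem: if \<open>g\<close> fixes \<open>a\<close> and \<open>b\<close> and \<open>\<rho>\<close> is the
  reflection in their midpoint \<open>z\<close>, then \<open>\<rho> g\<^sup>-\<^sup>1 \<rho> g\<close> also fixes \<open>a\<close> and \<open>b\<close>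
  and moves \<open>z\<close> twice as far as \<open>g\<close> does.\<close>

lemma isometry_fixes_midpoint:
  assumes S: "subspace S" "a \<in> S" "b \<in> S"
    and g: "g \<in> isometry_group S" "g a = a" "g b = b"
  shows "g (midpoint a b) = midpoint a b"
proof -
  define z where "z = midpoint a b"
  define r where "r x = a + b - x" for x
  have z: "z \<in> S"
    using S by (simp add: z_def midpoint_def subspace_add subspace_scale)
  have zz: "z + z = a + b"
    by (simp add: z_def midpoint_def flip: scaleR_left_distrib)
  have rz: "r z = z"
    using zz by (simp add: r_def diff_eq_eq)
  have r: "r \<in> isometry_group S"
    unfolding r_def by (intro reflection_isometry_group S)
  \<comment> \<open>The bound ranges over all admissible \<open>g\<close> because the induction
    hypothesis is applied to the composite map built from \<open>g\<close>.\<close>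
  have "\<forall>g\<in>isometry_group S. g a = a \<longrightarrow> g b = b \<longrightarrow> 2 ^ n * dist (g z) z \<le> 2 * dist a z" for n
  proof (induction n)
    case 0
    have "dist (g z) z \<le> 2 * dist a z" if "g \<in> isometry_group S" "g a = a" for g
    proof -
      have "dist (g z) a = dist z a"
        using that z S unfolding isometry_group_def by (metis (mono_tags, lifting) mem_Collect_eq)
      then show ?thesis
        using dist_triangle2[of "g z" z a] by (simp add: dist_commute)
    qed
    then show ?case by simp
  next
    case (Suc n)
    show ?case
    proof (intro ballI impI)
      fix g assume g: "g \<in> isometry_group S" "g a = a" "g b = b"
      let ?g' = "inv_into S g"
      have g': "?g' \<in> isometry_group S" "?g' a = a" "?g' b = b" "?g' (g z) = z"
        using g S z isometry_group_inv bij_betw_inv_into_left[of g S S]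
        by (auto simp: isometry_group_def) metis+
      have inS: "g z \<in> S" "r (g z) \<in> S" "?g' (r (g z)) \<in> S"
        using g(1) g'(1) r z by (auto simp: isometry_group_def bij_betw_apply)
      have "r \<circ> (?g' \<circ> (r \<circ> g)) \<in> isometry_group S"
        by (intro isometry_group_comp g g' r)
      moreover have "(r \<circ> (?g' \<circ> (r \<circ> g))) a = a" "(r \<circ> (?g' \<circ> (r \<circ> g))) b = b"
        using g g' by (simp_all add: r_def)
      ultimately have "2 ^ n * dist ((r \<circ> (?g' \<circ> (r \<circ> g))) z) z \<le> 2 * dist a z"
        using Suc by blast
      \<comment> \<open>The reflection fixes z and all maps are isometries, so the displacement of z
        is the distance from g z to its mirror image, twice the distance from g z to z.\<close>
      moreover have "dist ((r \<circ> (?g' \<circ> (r \<circ> g))) z) z = 2 * dist (g z) z"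
      proof -
        have "dist (r (?g' (r (g z)))) z = dist (r (?g' (r (g z)))) (r z)"
          by (simp add: rz)
        also have "\<dots> = dist (?g' (r (g z))) (?g' (g z))"
          using r inS z g'(4) by (simp add: isometry_group_def)
        also have "\<dots> = dist (r (g z)) (g z)"
          using g'(1) inS by (simp add: isometry_group_def)
        also have "\<dots> = norm (2 *\<^sub>R (z - g z))"
          unfolding r_def dist_norm scaleR_2 zz[symmetric] by (simp add: algebra_simps)
        also have "\<dots> = 2 * dist (g z) z"
          by (simp add: dist_norm norm_minus_commute)
        finally show ?thesis by simp
      qed
      ultimately show "2 ^ Suc n * dist (g z) z \<le> 2 * dist a z"
        by (simp add: mult.assoc mult.left_commute)
    qed
  qed
  then have bound: "2 ^ n * dist (g z) z \<le> 2 * dist a z" for n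
    using g by blast
  have "dist (g z) z = 0"
  proof (rule ccontr)
    assume "dist (g z) z \<noteq> 0"
    then have pos: "dist (g z) z > 0" by simp
    obtain n where "2 * dist a z / dist (g z) z < 2 ^ n"
      using real_arch_pow[of 2] by auto
    with pos bound[of n] show False
      by (simp add: field_simps)
  qed
  then show ?thesis by (simp add: z_def)
qed

text \<open>The reflection \<open>r'\<close> swaps f a and f b, and \<open>r\<close> swaps a and b,
  so the composite of \<open>f\<close>, \<open>r'\<close>, the inverse of \<open>f\<close> and
  \<open>r\<close> fixes a and b, hence also z. Unwinding this, \<open>r'\<close> fixes f z, which
  identifies f z as the midpoint of the images.\<close>

lemma isometry_midpoint:
  assumes S: "subspace S" "a \<in> S" "b \<in> S" and f: "f \<in> isometry_group S"
  shows "f (midpoint a b) = midpoint (f a) (f b)"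
proof -
  define z where "z = midpoint a b"
  define r where "r x = a + b - x" for x
  define r' where "r' x = f a + f b - x" for x
  let ?f' = "inv_into S f"
  have z: "z \<in> S"
    using S by (simp add: z_def midpoint_def subspace_add subspace_scale)
  have zz: "z + z = a + b"
    by (simp add: z_def midpoint_def flip: scaleR_left_distrib)
  have fS: "f a \<in> S" "f b \<in> S" "f z \<in> S"
    using f S z by (auto simp: isometry_group_def bij_betw_apply)
  have r: "r \<in> isometry_group S" and r': "r' \<in> isometry_group S"
    unfolding r_def r'_def by (intro reflection_isometry_group S fS)+
  have f': "?f' \<in> isometry_group S"
    by (intro isometry_group_inv f)
  have bij: "bij_betw f S S"
    using f by (simp add: isometry_group_def)
  have inv: "?f' (f a) = a" "?f' (f b) = b"
    using bij_betw_inv_into_left[OF bij] S by auto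
  have "(r \<circ> (?f' \<circ> (r' \<circ> f))) z = z"
    unfolding z_def
  proof (rule isometry_fixes_midpoint[OF S])
    show "r \<circ> (?f' \<circ> (r' \<circ> f)) \<in> isometry_group S"
      by (intro isometry_group_comp f f' r r')
  qed (use inv in \<open>simp_all add: r_def r'_def\<close>)
  then have "?f' (r' (f z)) = z"
    using zz by (simp add: r_def diff_eq_eq)
  moreover have "r' (f z) \<in> S"
    using r' fS by (auto simp: isometry_group_def bij_betw_apply)
  ultimately have "r' (f z) = f z"
    using bij_betw_inv_into_right[OF bij] by metis
  then have "2 *\<^sub>R f z = f a + f b"
    by (simp add: r'_def scaleR_2 algebra_simps)
  then have "f z = (1/2) *\<^sub>R (f a + f b)"
    by (metis scaleR_half_double scaleR_2 scaleR_add_right)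
  then show ?thesis by (simp add: z_def midpoint_def)
qed

text \<open>An additive h vanishing at 1 vanishes at the integers, so h (n t) depends only on the
  fractional part of n t and is bounded by K. Since h (n t) is n times h t, this forces h t =
  0.\<close>

lemma additive_bounded_imp_homogeneous:
  fixes h :: "real \<Rightarrow> 'v::real_normed_vector"
  assumes add: "\<And>s t. h (s + t) = h s + h t" and one: "h 1 = 0"
    and bound: "\<And>t. norm (h t) \<le> K * \<bar>t\<bar>"
  shows "h t = 0"
proof -
  have h0: "h 0 = 0" using add[of 0 0] by simp
  have hminus: "h (- s) = - h s" for s
    using add[of s "-s"] h0 by (simp add: eq_neg_iff_add_eq_0 add.commute)
  have hnat: "h (real n * s) = real n *\<^sub>R h s" for n s
    by (induction n) (simp_all add: h0 add algebra_simps)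
  have hint: "h (of_int m) = 0" for m
    using hnat[of _ 1] one hminus by (cases m rule: int_cases2) auto
  have K: "K \<ge> 0"
    using bound[of 1] norm_ge_zero[of "h 1"] by linarith
  have "real n * norm (h t) \<le> K" for n
  proof -
    have "real n *\<^sub>R h t = h (of_int \<lfloor>real n * t\<rfloor> + frac (real n * t))"
      by (simp add: hnat frac_def)
    also have "\<dots> = h (frac (real n * t))"
      by (simp add: add hint)
    finally have "real n * norm (h t) = norm (h (frac (real n * t)))"
      by (metis norm_scaleR abs_of_nat)
    also have "\<dots> \<le> K * 1"
      using K frac_ge_0[of "real n * t"] frac_lt_1[of "real n * t"]
      by (intro order_trans[OF bound] mult_left_mono) auto
    finally show ?thesis by simp
  qed
  then have "norm (h t) = 0"
    using K by (metis reals_Archimedean3 norm_ge_zero not_less order_le_less)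
  then show ?thesis by simp
qed

text \<open>Preservation of midpoints together with T 0 = 0 gives additivity of T. The failure of
  homogeneity, as a function of t, is additive, zero at 1 and linearly bounded, so the previous
  lemma removes it.\<close>

lemma isometry_affine:
  assumes S: "subspace S" and f: "f \<in> isometry_group S"
  shows isometry_affine_add: "\<And>x y. x \<in> S \<Longrightarrow> y \<in> S \<Longrightarrow> f (x + y) - f 0 = (f x - f 0) + (f y - f 0)"
    and isometry_affine_scale: "\<And>x t. x \<in> S \<Longrightarrow> f (t *\<^sub>R x) - f 0 = t *\<^sub>R (f x - f 0)"
proof -
  define T where "T x = f x - f 0" for x
  have T0: "T 0 = 0" by (simp add: T_def)
  have mid: "T ((1/2) *\<^sub>R (a + b)) = (1/2) *\<^sub>R (T a + T b)" if "a \<in> S" "b \<in> S" for a b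
    using isometry_midpoint[OF S that f]
    by (simp add: T_def midpoint_def algebra_simps flip: scaleR_left_distrib)
  have add: "T (x + y) = T x + T y" if "x \<in> S" "y \<in> S" for x y
  proof -
    have "x + y \<in> S" using S that by (rule subspace_add)
    then have "T ((1/2) *\<^sub>R (x + y)) = (1/2) *\<^sub>R T (x + y)"
      using mid[of "x + y" 0] subspace_0[OF S] by (simp add: T0)
    with mid[OF that] show ?thesis by simp
  qed
  have norm: "norm (T x) = norm x" if "x \<in> S" for x
    using f that subspace_0[OF S] by (simp add: T_def isometry_group_def dist_norm)
  have scale: "T (t *\<^sub>R x) = t *\<^sub>R T x" if x: "x \<in> S" for x t
  proof -
    have "T (t *\<^sub>R x) - t *\<^sub>R T x = 0"
    proof (rule
      additive_bounded_imp_homogeneous[where h = "\<lambda>t. T (t *\<^sub>R x) - t *\<^sub>R T x" and K = "2 * norm x"])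
      fix s t
      show "T ((s + t) *\<^sub>R x) - (s + t) *\<^sub>R T x = T (s *\<^sub>R x) - s *\<^sub>R T x + (T (t *\<^sub>R x) - t *\<^sub>R T x)"
        using x S by (simp add: scaleR_add_left add subspace_scale)
      show "norm (T (t *\<^sub>R x) - t *\<^sub>R T x) \<le> 2 * norm x * \<bar>t\<bar>"
        using norm_triangle_ineq4[of "T (t *\<^sub>R x)" "t *\<^sub>R T x"] x S
        by (simp add: norm subspace_scale mult.commute mult.left_commute)
    qed simp
    then show ?thesis by simp
  qed
  show "f (x + y) - f 0 = (f x - f 0) + (f y - f 0)" if "x \<in> S" "y \<in> S" for x y
    using add[OF that] by (simp add: T_def)
  show "f (t *\<^sub>R x) - f 0 = t *\<^sub>R (f x - f 0)" if "x \<in> S" for x t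
    using scale[OF that] by (simp add: T_def)
qed

section \<open>Linear order automorphisms of the Hermitian operators\<close>

text \<open>The norm of a Hermitian operator is its largest absolute eigenvalue. This is the bridge
  from preservation of order to preservation of distance.\<close>

lemma norm_hermitian_le_iff:
  assumes T: "T \<in> hermitian_ops" and c: "c \<ge> 0"
  shows "norm T \<le> c \<longleftrightarrow> form_le T c \<and> form_le (- T) c"
proof
  assume n: "norm T \<le> c"
  have "\<bar>inner (blinfun_apply T x) x\<bar> \<le> c * (norm x)\<^sup>2" for x
  proof -
    have "\<bar>inner (blinfun_apply T x) x\<bar> \<le> norm (blinfun_apply T x) * norm x"
      by (rule Cauchy_Schwarz_ineq2)
    also have "\<dots> \<le> (norm T * norm x) * norm x"
      by (intro mult_right_mono norm_blinfun) simp
    also have "\<dots> \<le> (c * norm x) * norm x"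
      by (intro mult_right_mono n) simp_all
    finally show ?thesis by (simp add: power2_eq_square mult.assoc)
  qed
  then show "form_le T c \<and> form_le (- T) c"
    unfolding form_le_def by (auto simp: blinfun.minus_left abs_le_iff)
next
  assume le: "form_le T c \<and> form_le (- T) c"
  obtain B a where B: "orthonormal_basis B" "T = diag_op B a"
    using spectral_decomposition[OF T] .
  note on = orthonormal_basisD(1)[OF B(1)]
  have a: "\<bar>a e\<bar> \<le> c" if e: "e \<in> B" for e
  proof -
    have ee: "cinner e e = 1"
      using orthonormalD[OF on e e] by simp
    then have "inner e e = 1" by (simp add: Re_cinner[symmetric])
    with le show ?thesis
      unfolding form_le_def
      by (auto simp: B(2) blinfun.minus_left diag_op_eigen[OF on e] power2_norm_eq_inner dest!:
        spec[of _ e])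
  qed
  show "norm T \<le> c"
  proof (rule norm_blinfun_bound[OF c])
    fix x
    have "(norm (blinfun_apply T x))\<^sup>2 = (\<Sum>e\<in>B. (cmod (cinner (blinfun_apply T x) e))\<^sup>2)"
      by (rule parseval(2)[OF B(1)])
    also have "\<dots> = (\<Sum>e\<in>B. \<bar>a e\<bar>\<^sup>2 * (cmod (cinner x e))\<^sup>2)"
      by (intro sum.cong refl) (simp add: B(2) cinner_diag_op[OF on] norm_mult power_mult_distrib)
    also have "\<dots> \<le> (\<Sum>e\<in>B. c\<^sup>2 * (cmod (cinner x e))\<^sup>2)"
      by (intro sum_mono mult_right_mono power_mono a) simp_all
    also have "\<dots> = (c * norm x)\<^sup>2"
      by (simp add: parseval(2)[OF B(1), of x] power_mult_distrib sum_distrib_left)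
    finally show "norm (blinfun_apply T x) \<le> c * norm x"
      by (rule power2_le_imp_le) (simp add: c)
  qed
qed

lemma hermitian_eq_scalar:
  assumes "T \<in> hermitian_ops" "form_le T c" "form_le (- T) (- c)"
  shows "T = c *\<^sub>R id_blinfun"
proof -
  have "norm (T - c *\<^sub>R id_blinfun) \<le> 0"
    using assms
    by (subst norm_hermitian_le_iff)
       (auto simp: hermitian_diff hermitian_scaleR hermitian_id form_le_def blinfun.diff_left
         blinfun.minus_left
         blinfun.scaleR_left inner_diff_left power2_norm_eq_inner)
  then show ?thesis by simp
qed

text \<open>Models the linear part of the transformed preserver. Preserving every bound c means
  preserving the largest eigenvalue. The laws are restricted to Hermitian operators since nothing is
  known about the map elsewhere in the type.\<close>

locale order_automorphism =
  fixes L :: "('a::{complex_inner,euclidean_space} \<Rightarrow>\<^sub>L 'a) \<Rightarrow> ('a \<Rightarrow>\<^sub>L 'a)"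
  assumes add: "\<And>S T. S \<in> hermitian_ops \<Longrightarrow> T \<in> hermitian_ops \<Longrightarrow> L (S + T) = L S + L T"
    and scale: "\<And>T r. T \<in> hermitian_ops \<Longrightarrow> L (r *\<^sub>R T) = r *\<^sub>R L T"
    and bij: "bij_betw L hermitian_ops hermitian_ops"
    and form_le_iff: "\<And>T c. T \<in> hermitian_ops \<Longrightarrow> form_le (L T) c \<longleftrightarrow> form_le T c"
begin

lemma hermitian: "T \<in> hermitian_ops \<Longrightarrow> L T \<in> hermitian_ops"
  using bij by (rule bij_betw_apply)

lemma zero: "L 0 = 0"
  using scale[OF hermitian_zero, of 0] by simp

lemma uminus: "T \<in> hermitian_ops \<Longrightarrow> L (- T) = - L T"
  using scale[of T "-1"] by simp

lemma diff: "S \<in> hermitian_ops \<Longrightarrow> T \<in> hermitian_ops \<Longrightarrow> L (S - T) = L S - L T"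
  using add[of S "- T"] by (simp add: uminus hermitian_minus)

lemma sum: "(\<And>i. i \<in> I \<Longrightarrow> F i \<in> hermitian_ops) \<Longrightarrow> L (sum F I) = (\<Sum>i\<in>I. L (F i))"
  by (induction I rule: infinite_finite_induct) (simp_all add: zero add hermitian_sum)

end

section \<open>Images of rank one projections under an order automorphism\<close>

lemma inner_outer_self: "inner (blinfun_apply (outer e e) x) x = (cmod (cinner x e))\<^sup>2"
proof -
  have "cinner (blinfun_apply (outer e e) x) x = cinner x e * cnj (cinner x e)"
    by (simp add: outer_apply cinner_simps cinner_commute[of e x])
  then show ?thesis
    by (simp add: Re_cinner[symmetric] complex_norm_square[symmetric] flip: of_real_power)
qed

lemma norm_eq_one_iff_cinner: "norm x = 1 \<longleftrightarrow> cinner x x = (1::complex)" for x :: "'a::complex_inner"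
  unfolding cinner_self of_real_eq_1_iff
  by (auto simp: power2_eq_1_iff) (use norm_ge_zero[of x] in linarith)

lemma orthonormal_singleton: "norm x = 1 \<Longrightarrow> orthonormal {x :: 'a::complex_inner}"
  by (simp add: orthonormal_def cinner_self)

lemma bessel:
  assumes "orthonormal (S :: 'a::{complex_inner,euclidean_space} set)"
  shows "(\<Sum>e\<in>S. (cmod (cinner x e))\<^sup>2) \<le> (norm x)\<^sup>2"
proof -
  obtain C where C: "S \<subseteq> C" "orthonormal_basis C"
    using orthonormal_basis_extension[OF assms] .
  show ?thesis
    unfolding parseval(2)[OF C(2), of x] using orthonormal_basisD(2)[OF C(2)] C(1)
    by (intro sum_mono2) auto
qed

lemma form_le_outer: "norm x = 1 \<Longrightarrow> form_le (outer x x) 1"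
  using bessel[OF orthonormal_singleton] by (auto simp: form_le_def inner_outer_self)

lemma form_nonneg_zero_imp_kernel:
  assumes "T \<in> hermitian_ops" "form_le (- T) 0" "inner (blinfun_apply T v) v = 0"
  shows "blinfun_apply T v = 0"
  using assms
  by (intro nonneg_form_zero_imp_kernel[of UNIV "blinfun_apply T" v])
     (auto simp: bounded_linear.linear[OF blinfun.bounded_linear_right] hermitian_inner form_le_def
       blinfun.minus_left)

text \<open>On the orthogonal complement of x the form of T is squeezed to 0, so T vanishes there;
  symmetry then forces T x to be a multiple of x.\<close>

lemma below_outer_imp_scaled:
  assumes x: "norm x = 1" and T: "T \<in> hermitian_ops" "form_le (- T) 0" "form_le (T - outer x x) 0"
  shows "T = inner (blinfun_apply T x) x *\<^sub>R outer x x"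
proof (rule blinfun_eqI)
  fix y
  have xx: "cinner x x = 1" using x by (simp add: cinner_self)
  have ker: "blinfun_apply T z = 0" if "cinner z x = 0" for z
  proof (rule form_nonneg_zero_imp_kernel[OF T(1,2)])
    show "inner (blinfun_apply T z) z = 0"
      using T(2)[unfolded form_le_def, rule_format, of z]
        T(3)[unfolded form_le_def, rule_format, of z] that
      by (simp add: blinfun.minus_left blinfun.diff_left inner_diff_left inner_outer_self)
  qed
  \<comment> \<open>The part of T x orthogonal to x. Its square norm is the product of T x with w,
    hence of x with T w, which is 0.\<close>
  define w where "w = blinfun_apply T x - cinner (blinfun_apply T x) x *\<^sub>C x"
  have wx: "cinner w x = 0" by (simp add: w_def cinner_simps xx)
  then have xw: "cinner x w = 0" using cinner_commute[of x w] by simp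
  have "cinner w w = cinner (blinfun_apply T x - cinner (blinfun_apply T x) x *\<^sub>C x) w"
    by (simp only: w_def[symmetric])
  also have "\<dots> = 0"
    by (simp add: cinner_diff_left cinner_scaleC_left xw hermitianD[OF T(1), of x w] ker[OF wx])
  finally have "w = 0" by simp
  then have Tx: "blinfun_apply T x = cinner (blinfun_apply T x) x *\<^sub>C x"
    by (simp add: w_def)
  have "cinner (blinfun_apply T x) x = of_real (inner (blinfun_apply T x) x)"
  proof -
    have "cnj (cinner (blinfun_apply T x) x) = cinner (blinfun_apply T x) x"
      using hermitianD[OF T(1), of x x] cinner_commute[of x "blinfun_apply T x"] by simp
    then show ?thesis
      by (metis Re_cinner Reals_cnj_iff of_real_Re)
  qed
  then have Tx': "blinfun_apply T x = inner (blinfun_apply T x) x *\<^sub>R x"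
    using Tx by (metis scaleC_of_real)
  have "blinfun_apply T (y - cinner y x *\<^sub>C x) = 0"
    by (rule ker) (simp add: cinner_simps xx)
  then have "blinfun_apply T y = cinner y x *\<^sub>C blinfun_apply T x"
    by (simp add: blinfun.diff_right hermitian_scaleC[OF T(1)])
  also have "\<dots> = blinfun_apply (inner (blinfun_apply T x) x *\<^sub>R outer x x) y"
    by (subst Tx') (simp add: blinfun.scaleR_left outer_apply scaleC_scaleR)
  finally show "blinfun_apply T y = blinfun_apply (inner (blinfun_apply T x) x *\<^sub>R outer x x) y" .
qed

lemma form_le_minus_outer: "form_le (- outer x x) 0"
  by (simp add: form_le_def blinfun.minus_left inner_outer_self)

context order_automorphism
begin

text \<open>The image is nonnegative and has an eigenvector y with eigenvalue at least 1, so it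
  dominates \<open>outer y y\<close>. Pulling this back, the preimage of \<open>outer y y\<close>
  lies between 0 and \<open>outer x x\<close>, hence is a multiple of \<open>outer x x\<close>, and
  the factor turns out to be 1.\<close>

lemma outer_unit:
  assumes x: "norm x = 1"
  obtains y where "norm y = 1" "L (outer x x) = outer y y"
proof -
  obtain B a where B: "orthonormal_basis B" "L (outer x x) = diag_op B a"
    using spectral_decomposition[OF hermitian[OF hermitian_outer]] .
  note on = orthonormal_basisD(1)[OF B(1)]
  have norm_e: "norm e = 1" if "e \<in> B" for e
    using orthonormalD[OF on that that] by (simp add: norm_eq_one_iff_cinner)
  have form_e: "inner (blinfun_apply (L (outer x x)) e) e = a e" if "e \<in> B" for e
    using norm_e[OF that] by (simp add: B(2) diag_op_eigen[OF on that]
      power2_norm_eq_inner[symmetric])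
  have "form_le (- L (outer x x)) 0"
    using form_le_iff[of "- outer x x" 0]
      by (simp add: uminus hermitian_outer hermitian_minus form_le_minus_outer)
  then have a_nonneg: "a e \<ge> 0" if "e \<in> B" for e
    using form_e[OF that] unfolding form_le_def by (auto simp: blinfun.minus_left dest: spec[of _ e])
  have "\<exists>e\<in>B. a e \<ge> 1"
  proof (rule ccontr)
    assume no: "\<not> (\<exists>e\<in>B. a e \<ge> 1)"
    \<comment> \<open>The inserted 0 makes the maximum meaningful for an empty set and stays below
      1.\<close>
    define m where "m = Max (insert 0 (a ` B))"
    have fin: "finite (insert 0 (a ` B))" using orthonormal_basisD(2)[OF B(1)] by simp
    have m: "m < 1" "\<And>e. e \<in> B \<Longrightarrow> a e \<le> m"
      using no fin by (auto simp: m_def)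
    have "form_le (L (outer x x)) m"
      unfolding form_le_def
    proof
      fix z
      have "inner (blinfun_apply (L (outer x x)) z) z = (\<Sum>e\<in>B. a e * (cmod (cinner z e))\<^sup>2)"
        by (simp add: B(2) Re_cinner[symmetric] cinner_diag_op_self del: of_real_sum)
      also have "\<dots> \<le> (\<Sum>e\<in>B. m * (cmod (cinner z e))\<^sup>2)"
        using m by (intro sum_mono mult_right_mono) auto
      also have "\<dots> = m * (norm z)\<^sup>2"
        by (simp add: parseval(2)[OF B(1), of z] sum_distrib_left)
      finally show "inner (blinfun_apply (L (outer x x)) z) z \<le> m * (norm z)\<^sup>2" .
    qed
    then have "form_le (outer x x) m"
      by (simp add: form_le_iff hermitian_outer)
    then have "inner (blinfun_apply (outer x x) x) x \<le> m * (norm x)\<^sup>2"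
      by (simp add: form_le_def)
    with m x show False by (simp add: inner_outer_self cinner_self)
  qed
  then obtain y where y: "y \<in> B" "a y \<ge> 1" by blast
  have norm_y: "norm y = 1" using norm_e y(1) .
  obtain T where T: "T \<in> hermitian_ops" "L T = outer y y"
    using bij_betw_imp_surj_on[OF bij] hermitian_outer[of y] by (metis image_iff)
  \<comment> \<open>All eigenvalues are nonnegative, so the spectral sum is at least its y-term,
    whose coefficient is at least 1.\<close>
  have "form_le (outer y y - L (outer x x)) 0"
    unfolding form_le_def
  proof
    fix z
    have "(cmod (cinner z y))\<^sup>2 \<le> a y * (cmod (cinner z y))\<^sup>2"
      using mult_right_mono[OF y(2), of "(cmod (cinner z y))\<^sup>2"] by simp
    also have "\<dots> \<le> (\<Sum>e\<in>B. a e * (cmod (cinner z e))\<^sup>2)"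
      using orthonormal_basisD(2)[OF B(1)] y(1) a_nonneg
      by (intro member_le_sum[of y B "\<lambda>e. a e * (cmod (cinner z e))\<^sup>2"]) auto
    also have "\<dots> = inner (blinfun_apply (L (outer x x)) z) z"
      by (simp add: B(2) Re_cinner[symmetric] cinner_diag_op_self del: of_real_sum)
    finally show "inner (blinfun_apply (outer y y - L (outer x x)) z) z \<le> 0 * (norm z)\<^sup>2"
      by (simp add: blinfun.diff_left inner_diff_left inner_outer_self)
  qed
  then have le: "form_le (T - outer x x) 0"
    using form_le_iff[of "T - outer x x" 0] T by (simp add: diff hermitian_diff hermitian_outer)
  have "form_le (- T) 0"
    using form_le_iff[of "- T" 0] T by (simp add: uminus hermitian_minus form_le_minus_outer)
  from below_outer_imp_scaled[OF x T(1) this le]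
  obtain c where c: "T = c *\<^sub>R outer x x" by blast
  have Ly: "outer y y = c *\<^sub>R L (outer x x)"
    using T(2) by (simp add: c scale hermitian_outer)
  then have "inner (blinfun_apply (outer y y) y) y = c * inner (blinfun_apply (L (outer x x)) y) y"
    by (simp add: blinfun.scaleR_left)
  then have "1 = c * a y"
    using norm_y by (simp add: inner_outer_self cinner_self form_e[OF y(1)])
  moreover have "c \<le> 1"
  proof -
    have "inner (blinfun_apply (T - outer x x) x) x \<le> 0"
      using le by (simp add: form_le_def)
    then show ?thesis
      using x by (simp add: c blinfun.diff_left blinfun.scaleR_left inner_diff_left inner_outer_self
        cinner_self)
  qed
  \<comment> \<open>The preserved upper bound 1 pins the eigenvalue \<open>a y\<close> to exactly 1,
    and then \<open>1 = c * a y\<close> gives \<open>c = 1\<close>.\<close>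
  moreover have "form_le (L (outer x x)) 1"
    by (simp add: form_le_iff hermitian_outer form_le_outer[OF x])
  then have "a y \<le> 1"
    using form_e[OF y(1)] norm_y unfolding form_le_def by (metis mult.right_neutral power_one)
  ultimately have "c = 1"
    using y(2) by simp
  with Ly norm_y that show ?thesis by simp
qed

text \<open>By Bessel, orthogonality puts the sum of the two projections below the identity. This
  bound is preserved, and evaluating it at y leaves no room for an overlap with y'.\<close>

lemma orthogonal_outer:
  assumes x: "norm x = 1" "norm x' = 1" "cinner x x' = 0"
    and y: "norm y = 1" "L (outer x x) = outer y y" and y': "L (outer x' x') = outer y' y'"
  shows "cinner y y' = 0"
proof -
  have "x \<noteq> x'" using x by (auto simp: cinner_self)
  have "cinner x' x = 0" using x(3) cinner_commute[of x' x] by simp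
  then have "orthonormal {x, x'}"
    using x \<open>x \<noteq> x'\<close> by (auto simp: orthonormal_def cinner_self)
  from bessel[OF this] have "form_le (outer x x + outer x' x') 1"
    using \<open>x \<noteq> x'\<close> by (simp add: form_le_def blinfun.add_left inner_add_left inner_outer_self)
  then have "form_le (outer y y + outer y' y') 1"
    using form_le_iff[of "outer x x + outer x' x'" 1] y y'
      by (simp add: add hermitian_add hermitian_outer)
  then have "inner (blinfun_apply (outer y y + outer y' y') y) y \<le> 1 * (norm y)\<^sup>2"
    unfolding form_le_def ..
  then show ?thesis
    using y(1) by (simp add: blinfun.add_left inner_add_left inner_outer_self cinner_self)
qed

end

section \<open>The Jordan property\<close>

lemma outer_comp: "outer u v o\<^sub>L outer u' v' = (outer (cinner u' v *\<^sub>C u) v' ::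
  'a::{complex_inner,euclidean_space} \<Rightarrow>\<^sub>L 'a)"
  by (rule blinfun_eqI) (simp add: outer_apply cinner_simps scaleC_scaleC)

lemma outer_zero_left [simp]: "outer 0 v = 0"
  by (rule blinfun_eqI) (simp add: outer_apply)

text \<open>Stated for an orthonormal family indexed by \<open>B\<close>, so that one computation
  serves both T with its eigenbasis and L T with the image vectors.\<close>

lemma diag_op_square:
  fixes a :: "'a::{complex_inner,euclidean_space} \<Rightarrow> real" and y :: "'a \<Rightarrow> 'a"
  assumes fin: "finite B"
    and y: "\<And>e f. e \<in> B \<Longrightarrow> f \<in> B \<Longrightarrow> cinner (y e) (y f) = (if e = f then 1 else 0)"
  shows "(\<Sum>e\<in>B. a e *\<^sub>R outer (y e) (y e)) o\<^sub>L (\<Sum>e\<in>B. a e *\<^sub>R outer (y e) (y e))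
    = (\<Sum>e\<in>B. (a e * a e) *\<^sub>R outer (y e) (y e))"
proof -
  have "(\<Sum>e\<in>B. a e *\<^sub>R outer (y e) (y e)) o\<^sub>L (\<Sum>e\<in>B. a e *\<^sub>R outer (y e) (y e))
      = (\<Sum>e\<in>B. \<Sum>f\<in>B. (a e * a f) *\<^sub>R (outer (y f) (y f) o\<^sub>L outer (y e) (y e)))"
    by (rule blinfun_eqI)
       (simp add: blinfun.sum_left blinfun.sum_right blinfun.scaleR_left blinfun.scaleR_right
         scaleR_sum_right)
  also have "\<dots> = (\<Sum>e\<in>B. \<Sum>f\<in>B. if f = e then (a e * a e) *\<^sub>R outer (y e) (y e) else 0)"
    by (intro sum.cong refl) (simp add: outer_comp y)
  also have "\<dots> = (\<Sum>e\<in>B. (a e * a e) *\<^sub>R outer (y e) (y e))"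
    using fin by simp
  finally show ?thesis .
qed

lemma hermitian_square: "T \<in> hermitian_ops \<Longrightarrow> T o\<^sub>L T \<in> hermitian_ops"
  by (simp add: hermitian_ops_def)

context order_automorphism
begin

text \<open>The eigenprojections of T go to mutually orthogonal rank one projections with the same
  coefficients, and squaring acts on the coefficients alone.\<close>

lemma square:
  assumes T: "T \<in> hermitian_ops"
  shows "L (T o\<^sub>L T) = L T o\<^sub>L L T"
proof -
  obtain B a where B: "orthonormal_basis B" "T = diag_op B a"
    using spectral_decomposition[OF T] .
  note on = orthonormal_basisD(1)[OF B(1)] and fin = orthonormal_basisD(2)[OF B(1)]
  have norm_e: "norm e = 1" if "e \<in> B" for e
    using orthonormalD[OF on that that] by (simp add: norm_eq_one_iff_cinner)
  have "\<exists>y. norm y = 1 \<and> L (outer e e) = outer y y" if "e \<in> B" for e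
    using outer_unit[OF norm_e[OF that]] by blast
  then obtain y where y: "\<And>e. e \<in> B \<Longrightarrow> norm (y e) = 1" "\<And>e. e \<in> B \<Longrightarrow> L (outer e e) = outer (y e) (y e)"
    by metis
  have yy: "cinner (y e) (y f) = (if e = f then 1 else 0)" if "e \<in> B" "f \<in> B" for e f
    using that y orthogonal_outer[of e f "y e" "y f"] orthonormalD[OF on, of e f] norm_e
    by (auto simp: cinner_self)
  have L_diag: "L (\<Sum>e\<in>B. b e *\<^sub>R outer e e) = (\<Sum>e\<in>B. b e *\<^sub>R outer (y e) (y e))" for b :: "'a \<Rightarrow> real"
    by (simp add: sum hermitian_scaleR hermitian_outer scale y)
  have "T o\<^sub>L T = (\<Sum>e\<in>B. (a e * a e) *\<^sub>R outer e e)"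
    unfolding B(2) diag_op_def using orthonormalD[OF on] by (rule diag_op_square[OF fin])
  then show ?thesis
    using diag_op_square[OF fin yy] by (simp add: L_diag B(2) diag_op_def)
qed

text \<open>Polarisation of the previous identity.\<close>

lemma jordan:
  assumes S: "S \<in> hermitian_ops" and T: "T \<in> hermitian_ops"
  shows "L ((S o\<^sub>L T) + (T o\<^sub>L S)) = (L S o\<^sub>L L T) + (L T o\<^sub>L L S)"
proof -
  have expand: "(X o\<^sub>L Y) + (Y o\<^sub>L X) = ((X + Y) o\<^sub>L (X + Y)) - (X o\<^sub>L X) - (Y o\<^sub>L Y)" for X Y ::
    "'a \<Rightarrow>\<^sub>L 'a"
    by (rule blinfun_eqI) (simp add: blinfun.add_left blinfun.add_right blinfun.diff_left)
  show ?thesis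
    unfolding expand using S T by (simp
      add: diff hermitian_diff hermitian_square hermitian_add square add)
qed

end

section \<open>Reconstruction of the implementing isometry\<close>

lemma outer_add_left: "outer (x + y) v = outer x v + outer y v"
  and outer_add_right: "outer u (x + y) = outer u x + outer u y"
  and outer_scaleR_left: "outer (r *\<^sub>R u) v = r *\<^sub>R outer u v"
  and outer_scaleR_right: "outer u (r *\<^sub>R v) = r *\<^sub>R outer u v"
  by (rule blinfun_eqI; simp add: outer_apply blinfun.add_left blinfun.scaleR_left cinner_simps
      scaleC_add_left scaleC_add_right scaleC_scaleR scaleC_scaleC[symmetric] scaleC_of_real
      del: complex_vector.scale_scale)+

lemma outer_scaleC: "outer (a *\<^sub>C x) (a *\<^sub>C x) = (cmod a)\<^sup>2 *\<^sub>R outer x x"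
proof (rule blinfun_eqI)
  fix z
  have "blinfun_apply (outer (a *\<^sub>C x) (a *\<^sub>C x)) z = (a * cnj a) *\<^sub>C (cinner z x *\<^sub>C x)"
    by (simp add: outer_apply cinner_simps scaleC_scaleC ac_simps)
  also have "\<dots> = (cmod a)\<^sup>2 *\<^sub>R (cinner z x *\<^sub>C x)"
    by (simp only: complex_norm_square[symmetric] scaleC_of_real)
  finally show "blinfun_apply (outer (a *\<^sub>C x) (a *\<^sub>C x)) z = blinfun_apply ((cmod a)\<^sup>2 *\<^sub>R outer x
    x) z"
    by (simp add: outer_apply blinfun.scaleR_left)
qed

text \<open>Equal rank one operators come from vectors that differ by a phase, and real
  orthogonality leaves only the phases \<open>\<i>\<close> and - \<open>\<i>\<close>. Applying both
  operators to w' makes this explicit.\<close>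

lemma scaleC_ii_cases:
  assumes eq: "outer w w = outer w' w'" and orth: "inner w w' = 0"
  shows "w' = \<i> *\<^sub>C w \<or> w' = - (\<i> *\<^sub>C w)"
proof (cases "w = 0 \<or> w' = 0")
  case True
  have "(cmod (cinner w w))\<^sup>2 = (cmod (cinner w w'))\<^sup>2" "(cmod (cinner w' w))\<^sup>2 = (cmod (cinner w'
    w'))\<^sup>2"
    using eq by (simp_all flip: inner_outer_self)
  with True have "w = 0 \<and> w' = 0" by auto
  then show ?thesis by simp
next
  case False
  have "(cmod (cinner w w))\<^sup>2 = (cmod (cinner w w'))\<^sup>2" "(cmod (cinner w' w))\<^sup>2 = (cmod (cinner w'
    w'))\<^sup>2"
    using eq by (simp_all flip: inner_outer_self)
  then have "cmod (cinner w w) = cmod (cinner w w')" "cmod (cinner w' w) = cmod (cinner w' w')"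
    by (auto intro: power2_eq_imp_eq)
  moreover have "cmod (cinner v v) = (norm v)\<^sup>2" for v :: 'a
    by (simp add: cinner_self norm_power)
  ultimately have cm: "cmod (cinner w' w) = (norm w)\<^sup>2" "cmod (cinner w' w) = (norm w')\<^sup>2"
    by (metis cmod_cinner_commute)+
  define s where "s = Im (cinner w' w)"
  have cs: "cinner w' w = \<i> * of_real s"
    using orth by (simp add: complex_eq_iff s_def Re_cinner inner_commute)
  with cm have s: "\<bar>s\<bar> = (norm w')\<^sup>2" by (simp add: norm_mult)
  have "blinfun_apply (outer w w) w' = blinfun_apply (outer w' w') w'"
    by (simp add: eq)
  then have "s *\<^sub>R (\<i> *\<^sub>C w) = (norm w')\<^sup>2 *\<^sub>R w'"
    unfolding outer_apply cs cinner_self scaleC_of_real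
    by (metis mult.commute scaleC_of_real scaleC_scaleC)
  moreover have "s = (norm w')\<^sup>2 \<or> s = - (norm w')\<^sup>2"
    using s by linarith
  ultimately have "(norm w')\<^sup>2 *\<^sub>R w' = (norm w')\<^sup>2 *\<^sub>R (\<i> *\<^sub>C w) \<or> (norm w')\<^sup>2 *\<^sub>R w' = (norm w')\<^sup>2
    *\<^sub>R (- (\<i> *\<^sub>C w))"
    by (metis scaleR_minus_left scaleR_minus_right)
  then show ?thesis
    using False unfolding scaleR_cancel_left by simp
qed

text \<open>Orthogonality removes the cross terms. The square links an operator that is real-linear
  in x to the quadratic \<open>outer x x\<close>, and L respects squares.\<close>

lemma outer_sym_square:
  assumes ee: "cinner e e = 1" and xe: "cinner x e = 0"
  shows "(outer x e + outer e x) o\<^sub>L (outer x e + outer e x) = outer x x + (norm x)\<^sup>2 *\<^sub>R outer e e"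
proof (rule blinfun_eqI)
  fix z
  have ex: "cinner e x = 0"
    using xe cinner_commute[of e x] by simp
  have xx: "cinner x x *\<^sub>C u = (norm x)\<^sup>2 *\<^sub>R u" for u :: 'a
    by (simp only: cinner_self scaleC_of_real)
  have "blinfun_apply ((outer x e + outer e x) o\<^sub>L (outer x e + outer e x)) z =
      cinner z x *\<^sub>C x + cinner z e *\<^sub>C (cinner x x *\<^sub>C e)"
    by (simp add: outer_apply blinfun.add_left cinner_simps ee xe ex)
  then show "blinfun_apply ((outer x e + outer e x) o\<^sub>L (outer x e + outer e x)) z =
      blinfun_apply (outer x x + (norm x)\<^sup>2 *\<^sub>R outer e e) z"
    by (simp only: xx) (simp add: outer_apply blinfun.add_left blinfun.scaleR_left scaleC_scaleR)
qed

text \<open>A group is not the union of two proper subgroups.\<close>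

lemma additive_eq_or_neg_uniform:
  assumes V: "subspace V" and add: "\<And>x y. x \<in> V \<Longrightarrow> y \<in> V \<Longrightarrow> F (x + y) = F x + F y"
    "\<And>x y. x \<in> V \<Longrightarrow> y \<in> V \<Longrightarrow> G (x + y) = G x + (G y :: 'b::real_vector)"
    and cases: "\<And>x. x \<in> V \<Longrightarrow> F x = G x \<or> F x = - G x"
  shows "(\<forall>x\<in>V. F x = G x) \<or> (\<forall>x\<in>V. F x = - G x)"
proof (rule ccontr)
  assume "\<not> ?thesis"
  then obtain x y where xy: "x \<in> V" "F x \<noteq> G x" "y \<in> V" "F y \<noteq> - G y" by blast
  then have "F x = - G x" "F y = G y" using cases by blast+
  moreover have "F (x + y) = G (x + y) \<or> F (x + y) = - G (x + y)"
    using xy V by (intro cases subspace_add)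
  ultimately show False
    using xy by (auto simp: add)
qed

context order_automorphism
begin

text \<open>Projections determine vectors only up to phase, so a vector map cannot be chosen
  pointwise. The real-linear operators \<open>S x\<close> fix all phases relative to e; this gives
  \<open>U\<close> on the complement of e, and \<open>W\<close> extends it by sending e to
  f.\<close>

lemma implemented_by_isometry:
  obtains U where "clinear U \<or> conjugate_linear U" "\<And>x. norm (U x) = norm x"
    "\<And>x. L (outer x x) = outer (U x) (U x)"
proof -
  obtain e :: 'a where e: "norm e = 1"
    using nonempty_Basis norm_Basis by blast
  obtain f where f: "norm f = 1" "L (outer e e) = outer f f"
    using outer_unit[OF e] .
  have ee: "cinner e e = 1" and ff: "cinner f f = 1"
    using e f by (simp_all add: cinner_self)
  define S where "S x = outer x e + outer e x" for x
  define U where "U x = blinfun_apply (L (S x)) f" for x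
  define V where "V = {x. cinner x e = 0}"
  have S: "S x \<in> hermitian_ops" for x by (simp add: S_def hermitian_outer2)
  have U_add: "U (x + y) = U x + U y" for x y
  proof -
    have "S (x + y) = S x + S y"
      by (simp add: S_def outer_add_left outer_add_right)
    then show ?thesis by (simp add: U_def add S blinfun.add_left)
  qed
  have U_scale: "U (r *\<^sub>R x) = r *\<^sub>R U x" for r x
  proof -
    have "S (r *\<^sub>R x) = r *\<^sub>R S x"
      by (simp add: S_def outer_scaleR_left outer_scaleR_right scaleR_add_right)
    then show ?thesis by (simp add: U_def scale S blinfun.scaleR_left)
  qed
  have V: "subspace V" "\<And>c x. x \<in> V \<Longrightarrow> c *\<^sub>C x \<in> V"
    by (auto simp: V_def subspace_def cinner_simps)

  have U_orth: "cinner (U x) f = 0" and L_S: "L (S x) = outer f (U x) + outer (U x) f"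
    and L_outer_U: "L (outer x x) = outer (U x) (U x)" and U_norm: "norm (U x) = norm x"
    if x: "x \<in> V" for x
  proof -
    have xe: "cinner x e = 0" "cinner e x = 0"
      using x cinner_commute[of e x] by (auto simp: V_def)
    let ?M = "L (S x)" and ?w = "U x"
    have M: "?M \<in> hermitian_ops" by (rule hermitian[OF S])
    \<comment> \<open>This Jordan equation says that \<open>S x\<close> is off-diagonal with respect
      to e. It is transported to f, where it determines the shape of L (S x).\<close>
    have "(outer e e o\<^sub>L S x) + (S x o\<^sub>L outer e e) = S x"
      by (rule blinfun_eqI)
         (simp add: S_def outer_apply blinfun.add_left cinner_simps ee xe scaleC_add_right
           scaleC_scaleC)
    then have "?M = (outer f f o\<^sub>L ?M) + (?M o\<^sub>L outer f f)"
      using jordan[OF hermitian_outer[of e] S[of x]] by (simp add: f)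
    then have Mz: "blinfun_apply ?M z = cinner (blinfun_apply ?M z) f *\<^sub>C f + cinner z f *\<^sub>C ?w" for z
      by (metis U_def M hermitian_scaleC blinfun.add_left blinfun_apply_blinfun_compose outer_apply)
    \<comment> \<open>At f the left side is w itself, so its component along f must vanish.\<close>
    from Mz[of f] have "cinner ?w f *\<^sub>C f = 0"
      by (simp add: ff U_def)
    then have "cinner (cinner ?w f *\<^sub>C f) f = 0" by (simp only: cinner_zero_left)
    then show wf: "cinner ?w f = 0"
      by (simp add: cinner_scaleC_left ff)
    then have fw: "cinner f ?w = 0" using cinner_commute[of f ?w] by simp
    have "cinner (blinfun_apply ?M z) f = cinner z ?w" for z
      by (simp add: hermitianD[OF M] U_def)
    with Mz have Mz': "blinfun_apply ?M z = cinner z ?w *\<^sub>C f + cinner z f *\<^sub>C ?w" for z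
      by metis
    then show L_S: "?M = outer f ?w + outer ?w f"
      by (intro blinfun_eqI) (simp add: blinfun.add_left outer_apply)
    have "S x o\<^sub>L S x = outer x x + (norm x)\<^sup>2 *\<^sub>R outer e e"
      unfolding S_def by (rule outer_sym_square[OF ee xe(1)])
    moreover have "?M o\<^sub>L ?M = outer ?w ?w + (norm ?w)\<^sup>2 *\<^sub>R outer f f"
      unfolding L_S using outer_sym_square[OF ff wf] by (simp add: add.commute)
    ultimately have L_outer: "L (outer x x) + (norm x)\<^sup>2 *\<^sub>R outer f f = outer ?w ?w + (norm ?w)\<^sup>2
      *\<^sub>R outer f f"
      using square[OF S[of x]] by (simp add: add scale hermitian_outer hermitian_scaleR f)
    show norm_w: "norm ?w = norm x"
    proof (cases "x = 0")
      case True
      then show ?thesis using U_scale[of 0 0] by simp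
    next
      case False
      \<comment> \<open>The image of the projection onto u is orthogonal to f. Evaluating
        \<open>L_outer\<close> at f therefore leaves only the two multiples of f, whose coefficients
        must agree.\<close>
      define u where "u = x /\<^sub>R norm x"
      have u: "norm u = 1" "cinner e u = 0" "x = norm x *\<^sub>R u"
        using False xe by (simp_all add: u_def cinner_simps)
      obtain y where y: "norm y = 1" "L (outer u u) = outer y y"
        using outer_unit[OF u(1)] .
      have "cinner f y = 0"
        by (rule orthogonal_outer[OF e u(1,2) f y(2)])
      moreover have "L (outer x x) = (norm x)\<^sup>2 *\<^sub>R outer y y"
        by (subst (1 2) u(3)) (simp add: outer_scaleR_left outer_scaleR_right scale hermitian_outer
          hermitian_scaleR y power2_eq_square)
      ultimately have "(norm x)\<^sup>2 *\<^sub>R f = (norm ?w)\<^sup>2 *\<^sub>R f"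
        using arg_cong[OF L_outer, of "\<lambda>T. blinfun_apply T f"]
        by (simp add: blinfun.add_left blinfun.scaleR_left outer_apply fw ff)
      then show ?thesis using f by auto
    qed
    show "L (outer x x) = outer ?w ?w"
      using L_outer by (simp add: norm_w)
  qed

  \<comment> \<open>Multiplying x by \<open>\<i>\<close> does not change \<open>outer x x\<close>,
    and expanding the norm of x + \<open>\<i>\<close> x gives the real orthogonality of the
    images.\<close>
  have "U (\<i> *\<^sub>C x) = \<i> *\<^sub>C U x \<or> U (\<i> *\<^sub>C x) = - (\<i> *\<^sub>C U x)" if x: "x \<in> V" for x
  proof (rule scaleC_ii_cases)
    have "outer (\<i> *\<^sub>C x) (\<i> *\<^sub>C x) = outer x x" by (simp add: outer_scaleC)
    then show "outer (U x) (U x) = outer (U (\<i> *\<^sub>C x)) (U (\<i> *\<^sub>C x))"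
      using L_outer_U x V(2) by metis
    have "(norm (U x + U (\<i> *\<^sub>C x)))\<^sup>2 = (norm (x + \<i> *\<^sub>C x))\<^sup>2"
      using x V by (simp add: U_norm subspace_add flip: U_add)
    moreover have "inner x (\<i> *\<^sub>C x) = 0"
      by (simp add: Im_cinner[symmetric] cinner_self)
    moreover have "(norm (a + b))\<^sup>2 = (norm a)\<^sup>2 + 2 * inner a b + (norm b)\<^sup>2" for a b :: 'a
      by (simp add: power2_norm_eq_inner inner_add_left inner_add_right inner_commute)
    ultimately show "inner (U x) (U (\<i> *\<^sub>C x)) = 0"
      using U_norm[OF x] U_norm[OF V(2)[OF x]] by simp
  qed
  then have "(\<forall>x\<in>V. U (\<i> *\<^sub>C x) = \<i> *\<^sub>C U x) \<or> (\<forall>x\<in>V. U (\<i> *\<^sub>C x) = - (\<i> *\<^sub>C U x))"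
    by (intro additive_eq_or_neg_uniform V) (auto simp: U_add scaleC_add_right)
  \<comment> \<open>With \<sigma> the identity or conjugation, the linear and the conjugate linear
    case run in parallel.\<close>
  then obtain \<sigma> where \<sigma>: "\<sigma> = (\<lambda>c. c) \<or> \<sigma> = cnj" and Ui: "\<And>x. x \<in> V \<Longrightarrow> U (\<i> *\<^sub>C x) = \<sigma> \<i> *\<^sub>C U x"
  proof (elim disjE)
    assume "\<forall>x\<in>V. U (\<i> *\<^sub>C x) = \<i> *\<^sub>C U x"
    then show thesis by (intro that[of "\<lambda>c. c"]) auto
  next
    assume "\<forall>x\<in>V. U (\<i> *\<^sub>C x) = - (\<i> *\<^sub>C U x)"
    then show thesis by (intro that[of cnj]) auto
  qed
  have \<sigma>_simps: "\<sigma> (a + b) = \<sigma> a + \<sigma> b" "\<sigma> (a * b) = \<sigma> a * \<sigma> b" "cmod (\<sigma> a) = cmod a" "\<sigma> (of_real r)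
    = of_real r" for a b r
    using \<sigma> by auto
  have U_scaleC: "U (c *\<^sub>C x) = \<sigma> c *\<^sub>C U x" if "x \<in> V" for c x
  proof -
    have "U (c *\<^sub>C x) = Re c *\<^sub>R U x + Im c *\<^sub>R (\<sigma> \<i> *\<^sub>C U x)"
      by (subst scaleC_Re_Im) (simp add: U_add U_scale Ui[OF that])
    also have "\<dots> = \<sigma> c *\<^sub>C U x"
      using \<sigma> by (subst (2) scaleC_Re_Im) auto
    finally show ?thesis .
  qed

  define W where "W v = U (v - cinner v e *\<^sub>C e) + \<sigma> (cinner v e) *\<^sub>C f" for v
  have inV: "v - cinner v e *\<^sub>C e \<in> V" for v
    by (simp add: V_def cinner_simps ee)
  have W_add: "W (x + y) = W x + W y" for x y
  proof -
    have "x + y - cinner (x + y) e *\<^sub>C e = (x - cinner x e *\<^sub>C e) + (y - cinner y e *\<^sub>C e)"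
      by (simp add: cinner_simps scaleC_add_left)
    then have *: "U (x + y - cinner (x + y) e *\<^sub>C e) = U (x - cinner x e *\<^sub>C e) + U (y - cinner y e
      *\<^sub>C e)"
      by (simp only: U_add)
    show ?thesis
      unfolding W_def * by (simp add: \<sigma>_simps cinner_add_left scaleC_add_left)
  qed
  have W_scaleC: "W (c *\<^sub>C x) = \<sigma> c *\<^sub>C W x" for c x
  proof -
    have "c *\<^sub>C x - cinner (c *\<^sub>C x) e *\<^sub>C e = c *\<^sub>C (x - cinner x e *\<^sub>C e)"
      by (simp add: cinner_simps scaleC_diff_right scaleC_scaleC)
    then have *: "U (c *\<^sub>C x - cinner (c *\<^sub>C x) e *\<^sub>C e) = \<sigma> c *\<^sub>C U (x - cinner x e *\<^sub>C e)"
      by (simp only: U_scaleC[OF inV])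
    show ?thesis
      unfolding W_def * by (simp add: \<sigma>_simps cinner_scaleC_left scaleC_add_right scaleC_scaleC)
  qed
  have "clinear W \<or> conjugate_linear W"
  proof -
    have "linear W"
      using W_scaleC[of "of_real _"] by (intro linearI W_add) (simp add: \<sigma>_simps scaleC_of_real)
    then show ?thesis
      using \<sigma> by (auto simp: conjugate_linear_def W_add W_scaleC intro!: clinearI)
  qed
  moreover have "norm (W v) = norm v" for v
  proof -
    let ?x = "v - cinner v e *\<^sub>C e"
    have "(norm (W v))\<^sup>2 = (norm (U ?x))\<^sup>2 + (norm (\<sigma> (cinner v e) *\<^sub>C f))\<^sup>2"
      unfolding W_def using U_orth[OF inV[of v]]
      by (intro norm_add_Pythagorean) (simp add: orthogonal_def Re_cinner[symmetric] cinner_simps)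
    also have "\<dots> = (norm ?x)\<^sup>2 + (norm (cinner v e *\<^sub>C e))\<^sup>2"
      by (simp add: U_norm[OF inV] norm_scaleC \<sigma>_simps e f)
    also have "\<dots> = (norm (?x + cinner v e *\<^sub>C e))\<^sup>2"
      by (intro norm_add_Pythagorean[symmetric]) (simp
        add: orthogonal_def Re_cinner[symmetric] cinner_simps ee)
    finally show ?thesis
      by (simp add: power2_eq_iff_nonneg)
  qed
  moreover have "L (outer v v) = outer (W v) (W v)" for v
  proof -
    text \<open>Up to a phase, \<open>v\<close> has a nonnegative real component along \<open>e\<close>.\<close>
    define t where "t = cmod (cinner v e)"
    obtain \<theta> where \<theta>: "cmod \<theta> = 1" "cnj \<theta> * cinner v e = of_real t"
    proof (cases "cinner v e = 0")
      case True
      then show ?thesis using that[of 1] by (simp add: t_def)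
    next
      case False
      have "cnj (sgn (cinner v e)) * cinner v e = of_real t"
        using False complex_norm_square[of "cinner v e"]
        by (simp add: sgn_div_norm t_def power2_eq_square field_simps scaleR_conv_of_real)
      with False show ?thesis using that[of "sgn (cinner v e)"] by (simp add: norm_sgn)
    qed
    define v' where "v' = cnj \<theta> *\<^sub>C v"
    define x where "x = v' - t *\<^sub>R e"
    have v'e: "cinner v' e = of_real t"
      using \<theta> by (simp add: v'_def cinner_simps)
    then have x: "x \<in> V" "v' = x + t *\<^sub>R e"
      by (simp_all add: x_def V_def cinner_simps ee)
    have W: "W v' = U x + t *\<^sub>R f"
      by (simp add: W_def v'e \<sigma>_simps scaleC_of_real x_def)
    \<comment> \<open>Because the component along e has been made real, the cross term is a real
      multiple of \<open>S x\<close>, whose image under L is known.\<close>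
    have "outer v' v' = outer x x + t *\<^sub>R S x + (t * t) *\<^sub>R outer e e"
      by (simp add: x(2) S_def outer_add_left outer_add_right outer_scaleR_left outer_scaleR_right
        scaleR_add_right)
    then have "L (outer v' v') = outer (U x) (U x) + t *\<^sub>R (outer f (U x) + outer (U x) f) + (t * t)
      *\<^sub>R outer f f"
      by (simp add: add scale hermitian_add hermitian_scaleR hermitian_outer S f L_outer_U[OF x(1)]
        L_S[OF x(1)])
    also have "\<dots> = outer (W v') (W v')"
      by (simp add: W outer_add_left outer_add_right outer_scaleR_left outer_scaleR_right
        scaleR_add_right)
    finally show ?thesis
      using \<theta> by (simp add: v'_def W_scaleC outer_scaleC \<sigma>_simps)
  qed
  ultimately show ?thesis
    using that by blast
qed

end

section \<open>Unitary and antiunitary operators\<close>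

lemma isometry_linear:
  fixes U :: "'a::{complex_inner,euclidean_space} \<Rightarrow> 'a"
  assumes "clinear U \<or> conjugate_linear U"
  shows "linear U"
proof -
  have "linear U" if "conjugate_linear U"
    using that by (intro linearI) (auto simp: conjugate_linear_def scaleC_of_real[symmetric] simp
      del: scaleC_of_real)
  then show ?thesis
    using assms clinear_imp_linear by blast
qed

text \<open>A real-linear isometry preserves the real inner product. The imaginary part of
  \<open>cinner\<close> is the real product with \<open>\<i>\<close> y, so it is kept or negated
  according to how U passes \<open>\<i>\<close>. Bijectivity comes from finite dimension.\<close>

lemma isometry_cinner:
  fixes U :: "'a::{complex_inner,euclidean_space} \<Rightarrow> 'a"
  assumes norm: "\<And>x. norm (U x) = norm x"
  shows clinear_isometry_cinner: "clinear U \<Longrightarrow> cinner (U x) (U y) = cinner x y"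
    and conjugate_linear_isometry_cinner: "conjugate_linear U \<Longrightarrow> cinner (U x) (U y) = cnj (cinner x y)"
    and isometry_bij: "clinear U \<or> conjugate_linear U \<Longrightarrow> bij U"
proof -
  have orth: "orthogonal_transformation U" if "clinear U \<or> conjugate_linear U"
    using isometry_linear[OF that] by (simp add: orthogonal_transformation norm)
  then show "clinear U \<or> conjugate_linear U \<Longrightarrow> bij U"
    by (blast intro: orthogonal_transformation_bij)
  have inner: "inner (U x) (U y) = inner x y" if "clinear U \<or> conjugate_linear U" for x y
    using orth[OF that] by (simp add: orthogonal_transformation_def)
  show "cinner (U x) (U y) = cinner x y" if "clinear U"
    using that by (simp add: cinner_eq_inner inner flip: clinear_scaleC)
  show "cinner (U x) (U y) = cnj (cinner x y)" if U: "conjugate_linear U"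
  proof -
    have "\<i> *\<^sub>C U y = U (- (\<i> *\<^sub>C y))"
      using U unfolding conjugate_linear_def
      by (metis complex_cnj_i complex_cnj_minus minus_minus complex_vector.scale_minus_left)
    then show ?thesis
      using U by (simp add: cinner_eq_inner inner complex_cnj)
  qed
qed

text \<open>For completeness, the remainder of an expansion in the images is U y for some y
  orthogonal to the whole basis, hence zero.\<close>

lemma isometry_image_basis:
  fixes U :: "'a::{complex_inner,euclidean_space} \<Rightarrow> 'a"
  assumes U: "clinear U \<or> conjugate_linear U" and norm: "\<And>x. norm (U x) = norm x"
    and B: "orthonormal_basis B"
  shows "orthonormal_basis (U ` B)"
proof -
  note on = orthonormal_basisD(1)[OF B]
  have inj: "U x = U y \<longleftrightarrow> x = y" for x y
    using isometry_bij[OF norm U] by (auto simp: bij_def inj_def)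
  have cinner: "cinner (U x) (U y) = cinner x y \<or> cinner (U x) (U y) = cnj (cinner x y)" for x y
    using isometry_cinner(1,2)[OF norm] U by blast
  have "cinner (U e) (U f) = (if e = f then 1 else 0)" if "e \<in> B" "f \<in> B" for e f
    using cinner[of e f] orthonormalD[OF on that] by auto
  then have on': "orthonormal (U ` B)"
    by (auto simp: orthonormal_def inj)
  have "x = (\<Sum>e\<in>U ` B. cinner x e *\<^sub>C e)" for x
  proof -
    let ?r = "x - (\<Sum>e\<in>U ` B. cinner x e *\<^sub>C e)"
    have r: "cinner ?r (U e) = 0" if "e \<in> B" for e
      using that by (simp add: cinner_diff_left cinner_orthonormal_sum[OF on'])
    obtain y where y: "?r = U y"
      using isometry_bij[OF norm U] by (metis bij_pointE)
    have "cinner y e = cinner 0 e" if "e \<in> B" for e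
      using r[OF that] cinner[of y e] unfolding y by auto
    then have "y = 0"
      by (rule orthonormal_basis_ext[OF B])
    then have "?r = 0"
      using y norm[of y] by simp
    then show ?thesis by simp
  qed
  with on' show ?thesis
    by (simp add: orthonormal_basis_iff)
qed

lemma cinner_right_ext:
  assumes "\<And>z. cinner z x = cinner z y"
  shows "x = (y::'a::complex_inner)"
  by (rule cinner_left_ext) (metis assms cinner_commute)

text \<open>The inverse of U solves the adjoint equation, and nondegeneracy makes the solution
  unique, so the definite description evaluates to \<open>inv U\<close>.\<close>

lemma clinear_isometry:
  fixes U :: "'a::{complex_inner,euclidean_space} \<Rightarrow> 'a"
  assumes U: "clinear U" and norm: "\<And>x. norm (U x) = norm x"
  shows clinear_isometry_unitary: "unitary_op U"
    and clinear_isometry_cadjoint: "cinner (cadjoint U x) y = cinner x (U y)"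
proof -
  have bij: "bij U" using isometry_bij[OF norm] U by blast
  have adj: "cinner (U x) y = cinner x (inv U y)" for x y
    using clinear_isometry_cinner[OF norm U, of x "inv U y"] bij
      by (simp add: bij_is_surj surj_f_inv_f)
  have adj_eq: "cadjoint U = inv U"
    unfolding cadjoint_def
  proof (rule the_equality)
    fix V assume "\<forall>x y. cinner (U x) y = cinner x (V y)"
    then have "cinner x (V y) = cinner x (inv U y)" for x y
      by (simp flip: adj)
    then show "V = inv U"
      by - (rule ext, rule cinner_right_ext, blast)
  qed (simp add: adj)
  with U bij show "unitary_op U"
    by (simp add: unitary_op_def bij_is_inj bij_is_surj fun_eq_iff surj_f_inv_f)
  show "cinner (cadjoint U x) y = cinner x (U y)"
    unfolding adj_eq using adj[of y x] by (metis cinner_commute)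
qed

lemma conjugate_linear_isometry:
  fixes U :: "'a::{complex_inner,euclidean_space} \<Rightarrow> 'a"
  assumes U: "conjugate_linear U" and norm: "\<And>x. norm (U x) = norm x"
  shows conjugate_linear_isometry_antiunitary: "antiunitary_op U"
    and conjugate_linear_isometry_adjoint: "cinner (antilinear_adjoint U x) y = cnj (cinner x (U y))"
proof -
  have bij: "bij U" using isometry_bij[OF norm] U by blast
  have adj: "cinner (U x) y = cnj (cinner x (inv U y))" for x y
    using conjugate_linear_isometry_cinner[OF norm U, of x "inv U y"] bij
    by (simp add: bij_is_surj surj_f_inv_f)
  have adj_eq: "antilinear_adjoint U = inv U"
    unfolding antilinear_adjoint_def
  proof (rule the_equality)
    fix V assume "\<forall>x y. cinner (U x) y = cnj (cinner x (V y))"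
    then have "cinner x (V y) = cinner x (inv U y)" for x y
      by (metis adj complex_cnj_cancel_iff)
    then show "V = inv U"
      by - (rule ext, rule cinner_right_ext, blast)
  qed (simp add: adj)
  show "cinner (antilinear_adjoint U x) y = cnj (cinner x (U y))"
    unfolding adj_eq using adj[of y x] by (metis cinner_commute)
  show "antiunitary_op U"
    by (simp add: antiunitary_op_def bij U norm)
qed

lemma diag_op_image:
  assumes "inj U"
  shows "diag_op (U ` B) a = (\<Sum>e\<in>B. a (U e) *\<^sub>R outer (U e) (U e))"
  using assms by (simp add: diag_op_def sum.reindex inj_on_subset)

text \<open>\<open>V\<close> stands for either kind of adjoint, and \<open>adj\<close> is the
  property the two share, so the unitary and antiunitary cases need one computation only. The scalar
  summand becomes the factor \<open>exp c\<close>.\<close>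

lemma op_exp_conjugated:
  fixes U :: "'a::{complex_inner,euclidean_space} \<Rightarrow> 'a"
  assumes U: "clinear U \<or> conjugate_linear U" and norm: "\<And>x. norm (U x) = norm x"
    and adj: "\<And>e. U (cinner (V x) e *\<^sub>C e) = cinner x (U e) *\<^sub>C U e"
    and B: "orthonormal_basis B"
  shows "op_exp (blinfun_apply ((\<Sum>e\<in>B. a e *\<^sub>R outer (U e) (U e)) + c *\<^sub>R id_blinfun)) x
    = exp c *\<^sub>R U (op_exp (blinfun_apply (diag_op B a)) (V x))"
proof -
  interpret U: linear U by (rule isometry_linear[OF U])
  have inj: "inj U" using isometry_bij[OF norm U] by (rule bij_is_inj)
  note UB = isometry_image_basis[OF U norm B]
  have "(\<Sum>e\<in>B. a e *\<^sub>R outer (U e) (U e)) + c *\<^sub>R id_blinfun = diag_op (U ` B) (\<lambda>f. a (inv U f) + c)"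
    using inj by (simp add: diag_op_const[OF UB, symmetric] diag_op_image sum.distrib scaleR_add_left)
  then have diag: "blinfun_apply ((\<Sum>e\<in>B. a e *\<^sub>R outer (U e) (U e)) + c *\<^sub>R id_blinfun)
      = blinfun_apply (diag_op (U ` B) (\<lambda>f. a (inv U f) + c))"
    by simp
  have "op_exp (blinfun_apply ((\<Sum>e\<in>B. a e *\<^sub>R outer (U e) (U e)) + c *\<^sub>R id_blinfun)) x
      = (\<Sum>e\<in>B. exp (a e + c) *\<^sub>R (cinner x (U e) *\<^sub>C U e))"
    unfolding diag functional_calculus_diag_op[OF UB] using inj
    by (simp add: diag_op_image blinfun.sum_left blinfun.scaleR_left outer_apply)
  also have "\<dots> = (\<Sum>e\<in>B. exp c *\<^sub>R exp (a e) *\<^sub>R U (cinner (V x) e *\<^sub>C e))"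
    by (simp add: adj exp_add mult.commute)
  also have "\<dots> = exp c *\<^sub>R U (\<Sum>e\<in>B. exp (a e) *\<^sub>R (cinner (V x) e *\<^sub>C e))"
    by (simp add: U.sum U.scale scaleR_sum_right)
  also have "\<dots> = exp c *\<^sub>R U (op_exp (blinfun_apply (diag_op B a)) (V x))"
    by (simp add: functional_calculus_diag_op[OF B] diag_op_apply)
  finally show ?thesis .
qed

section \<open>Preservers of the divergence\<close>

lemma form_le_scaleR:
  assumes "r > 0"
  shows "form_le (r *\<^sub>R D) (r * c) \<longleftrightarrow> form_le D c"
  using assms by (simp add: form_le_def blinfun.scaleR_left mult.assoc)

text \<open>A change of variables in the trace criterion: every Hermitian Z has the form \<alpha> X
  + Y.\<close>

lemma form_le_iff_tr_exp_affine:
  assumes "D \<in> hermitian_ops" "Y \<in> hermitian_ops" "\<alpha> \<noteq> 0"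
  shows "form_le D c \<longleftrightarrow> (\<forall>X\<in>hermitian_ops. tr_exp (\<alpha> *\<^sub>R X + (Y + D)) \<le> exp c * tr_exp (\<alpha> *\<^sub>R X + Y))"
proof -
  have "Z = \<alpha> *\<^sub>R ((1 / \<alpha>) *\<^sub>R (Z - Y)) + Y" for Z
    using assms(3) by simp
  then have "(\<forall>Z\<in>hermitian_ops. tr_exp (Z + D) \<le> exp c * tr_exp Z) \<longleftrightarrow>
      (\<forall>X\<in>hermitian_ops. tr_exp (\<alpha> *\<^sub>R X + Y + D) \<le> exp c * tr_exp (\<alpha> *\<^sub>R X + Y))"
    using assms(2) by (metis hermitian_add hermitian_diff hermitian_scaleR)
  then show ?thesis
    using form_le_iff_tr_exp[OF assms(1)] by (simp add: add.assoc)
qed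

text \<open>The trace criterion is applied to a positive multiple of Y' - Y. For \<alpha> > 1 the
  coefficient 1 - \<alpha> is negative, so Y and Y' exchange roles.\<close>

lemma form_le_diff_iff_tr_exp:
  assumes "Y \<in> hermitian_ops" "Y' \<in> hermitian_ops" "\<alpha> > 0" "\<alpha> \<noteq> 1"
  defines "G \<equiv> \<lambda>X Y. tr_exp (\<alpha> *\<^sub>R X + (1 - \<alpha>) *\<^sub>R Y)"
  shows "form_le (Y' - Y) c \<longleftrightarrow>
    (if \<alpha> < 1 then \<forall>X\<in>hermitian_ops. G X Y' \<le> exp ((1 - \<alpha>) * c) * G X Y
     else \<forall>X\<in>hermitian_ops. G X Y \<le> exp ((\<alpha> - 1) * c) * G X Y')"
proof (cases "\<alpha> < 1")
  case True
  have "(1 - \<alpha>) *\<^sub>R Y + (1 - \<alpha>) *\<^sub>R (Y' - Y) = (1 - \<alpha>) *\<^sub>R Y'"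
    by (simp add: scaleR_diff_right)
  with True assms show ?thesis
    using form_le_scaleR[of "1 - \<alpha>" "Y' - Y" c]
      form_le_iff_tr_exp_affine[of "(1 - \<alpha>) *\<^sub>R (Y' - Y)" "(1 - \<alpha>) *\<^sub>R Y" \<alpha> "(1 - \<alpha>) * c"]
    by (simp add: hermitian_scaleR hermitian_diff)
next
  case False
  have "(1 - \<alpha>) *\<^sub>R Y' + (\<alpha> - 1) *\<^sub>R (Y' - Y) = (1 - \<alpha>) *\<^sub>R Y"
    by (simp add: algebra_simps)
  with False assms show ?thesis
    using form_le_scaleR[of "\<alpha> - 1" "Y' - Y" c]
      form_le_iff_tr_exp_affine[of "(\<alpha> - 1) *\<^sub>R (Y' - Y)" "(1 - \<alpha>) *\<^sub>R Y'" \<alpha> "(\<alpha> - 1) * c"]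
    by (simp add: hermitian_scaleR hermitian_diff)
qed

lemma dist_eq_of_form_le_iff:
  assumes "S \<in> hermitian_ops" "T \<in> hermitian_ops" "S' \<in> hermitian_ops" "T' \<in> hermitian_ops"
    and "\<And>c. form_le (S' - T') c \<longleftrightarrow> form_le (S - T) c" "\<And>c. form_le (T' - S') c \<longleftrightarrow> form_le (T - S) c"
  shows "dist S' T' = dist S T"
proof -
  have "norm (S' - T') \<le> c \<longleftrightarrow> norm (S - T) \<le> c" if "c \<ge> 0" for c
    using norm_hermitian_le_iff[OF hermitian_diff[OF assms(3,4)] that]
      norm_hermitian_le_iff[OF hermitian_diff[OF assms(1,2)] that]
    by (simp add: assms(5,6))
  from this[of "norm (S - T)"] this[of "norm (S' - T')"] show ?thesis
    by (simp add: dist_norm)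
qed

text \<open>The ratio identity meets the trace criterion for Y with bound ln k and, read at Z - Y,
  for -Y with bound -ln k; the two bounds squeeze Y.\<close>

lemma tr_exp_scalar_ratio:
  assumes Y: "Y \<in> hermitian_ops" and k: "k > 0" and ratio:
    "\<And>Z. Z \<in> hermitian_ops \<Longrightarrow> tr_exp (Z + Y) = k * tr_exp Z"
  shows "Y = ln k *\<^sub>R id_blinfun"
proof (rule hermitian_eq_scalar[OF Y])
  show "form_le Y (ln k)"
    using form_le_iff_tr_exp[OF Y, of "ln k"] ratio k by simp
  have "tr_exp (Z + - Y) \<le> exp (- ln k) * tr_exp Z" if Z: "Z \<in> hermitian_ops" for Z
    using ratio[OF hermitian_diff[OF Z Y]] k by (simp add: exp_minus field_simps)
  then show "form_le (- Y) (- ln k)"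
    using form_le_iff_tr_exp[OF hermitian_minus[OF Y], of "- ln k"] by blast
qed

theorem theorem1:
  fixes \<phi> :: "('h::{complex_inner, euclidean_space} \<Rightarrow> 'h) \<Rightarrow> ('h \<Rightarrow> 'h)"
    and \<alpha> :: real
  assumes "complex_vector.dim (UNIV :: 'h set) \<ge> 2"
    and "\<alpha> \<in> {0<..<1} \<union> {1<..}"
    and "bij_betw \<phi> positive_definite_ops positive_definite_ops"
    and "\<And>A B. A \<in> positive_definite_ops \<Longrightarrow> B \<in> positive_definite_ops \<Longrightarrow>
      renyi_flat \<alpha> (\<phi> A) (\<phi> B) = renyi_flat \<alpha> A B"
  shows "\<exists>U :: 'h \<Rightarrow> 'h. \<exists>c :: real. c > 0 \<and>
    (unitary_op U \<and> (\<forall>A\<in>positive_definite_ops. \<phi> A = (\<lambda>x. c *\<^sub>R U (A (cadjoint U x)))) \<or>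
     antiunitary_op U \<and> (\<forall>A\<in>positive_definite_ops. \<phi> A = (\<lambda>x. c *\<^sub>R U (A (antilinear_adjoint U x)))))"
proof -
  have \<alpha>: "\<alpha> > 0" "\<alpha> \<noteq> 1" using assms(2) by auto
  define E :: "('h \<Rightarrow>\<^sub>L 'h) \<Rightarrow> 'h \<Rightarrow> 'h" where "E X = op_exp (blinfun_apply X)" for X
  have E: "bij_betw E hermitian_ops positive_definite_ops" and log: "bij_betw log_op
    positive_definite_ops (hermitian_ops :: ('h \<Rightarrow>\<^sub>L 'h) set)"
    by (rule bij_betw_byWitness[where f' = log_op] bij_betw_byWitness[where f' = E];
        auto simp: E_def op_exp_positive_definite log_op_op_exp log_op_hermitian op_exp_log_op)+
  define \<psi> where "\<psi> = log_op \<circ> (\<phi> \<circ> E)"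
  have \<psi>: "bij_betw \<psi> hermitian_ops hermitian_ops"
    unfolding \<psi>_def by (rule bij_betw_trans[OF bij_betw_trans[OF E assms(3)] log])
  then have \<psi>_hermitian: "\<psi> X \<in> hermitian_ops" if "X \<in> hermitian_ops" for X
    using that by (rule bij_betw_apply)
  define G :: "('h \<Rightarrow>\<^sub>L 'h) \<Rightarrow> ('h \<Rightarrow>\<^sub>L 'h) \<Rightarrow> real"
    where "G X Y = tr_exp (\<alpha> *\<^sub>R X + (1 - \<alpha>) *\<^sub>R Y)" for X Y
  have G_pos: "G X Y > 0" if "X \<in> hermitian_ops" "Y \<in> hermitian_ops" for X Y
    unfolding G_def using that by (intro tr_exp_pos hermitian_add hermitian_scaleR)
  \<comment> \<open>The factor \<open>inverse (\<alpha> - 1)\<close> is nonzero and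
    \<open>ln\<close> is injective on positive reals, so equal divergences mean equal
    ratios.\<close>
  have ratio: "G (\<psi> X) (\<psi> Y) / tr_exp (\<psi> X) = G X Y / tr_exp X"
    if X: "X \<in> hermitian_ops" and Y: "Y \<in> hermitian_ops" for X Y
  proof -
    have pd: "E X \<in> positive_definite_ops" "E Y \<in> positive_definite_ops"
        "\<phi> (E X) \<in> positive_definite_ops" "\<phi> (E Y) \<in> positive_definite_ops"
      using X Y bij_betw_apply[OF E] bij_betw_apply[OF assms(3)] by blast+
    have "ln (inverse (tr_exp (\<psi> X)) * G (\<psi> X) (\<psi> Y)) = ln (inverse (tr_exp X) * G X Y)"
      using assms(4)[OF pd(1,2)] \<alpha>(2) X Y
      by (simp add: renyi_flat_log_op pd G_def \<psi>_def) (simp add: E_def log_op_op_exp)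
    then show ?thesis
      using X Y \<psi>_hermitian by (simp add: ln_inj_iff G_pos tr_exp_pos divide_inverse mult.commute)
  qed

  \<comment> \<open>The denominators depend on X alone, so they cancel when Y and Y' are compared at
    the same X; surjectivity of \<psi> then lets \<psi> X range over all Hermitian
    operators.\<close>
  have G_iff: "(\<forall>X\<in>hermitian_ops. G X (\<psi> Y') \<le> k * G X (\<psi> Y)) \<longleftrightarrow> (\<forall>X\<in>hermitian_ops. G X Y' \<le> k * G X
    Y)"
    if Y: "Y \<in> hermitian_ops" "Y' \<in> hermitian_ops" for Y Y' k
  proof -
    have "G (\<psi> X) (\<psi> Y') \<le> k * G (\<psi> X) (\<psi> Y) \<longleftrightarrow> G X Y' \<le> k * G X Y" if X: "X \<in> hermitian_ops" for X
    proof -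
      have pos: "tr_exp X > 0" "tr_exp (\<psi> X) > 0"
        using X \<psi>_hermitian by (auto intro: tr_exp_pos)
      have div: "a \<le> k * b \<longleftrightarrow> a / t \<le> k * (b / t)" if "t > 0" for a b t
        using that by (simp add: divide_le_cancel)
      show ?thesis
        unfolding div[OF pos(2), of "G (\<psi> X) (\<psi> Y')"] div[OF pos(1), of "G X Y'"]
          ratio[OF X Y(1)] ratio[OF X Y(2)] ..
    qed
    then show ?thesis
      using bij_betw_imp_surj_on[OF \<psi>] by (metis (no_types, lifting) image_iff \<psi>_hermitian)
  qed
  have form_le_\<psi>: "form_le (\<psi> Y' - \<psi> Y) c \<longleftrightarrow> form_le (Y' - Y) c"
    if "Y \<in> hermitian_ops" "Y' \<in> hermitian_ops" for Y Y' c
    using form_le_diff_iff_tr_exp[OF that \<alpha>]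
      form_le_diff_iff_tr_exp[OF \<psi>_hermitian \<psi>_hermitian \<alpha>, OF that] G_iff that
    by (simp add: G_def)

  have "\<psi> \<in> isometry_group hermitian_ops"
    using \<psi> by (auto simp: isometry_group_def intro!: dist_eq_of_form_le_iff \<psi>_hermitian form_le_\<psi>)
  note affine = isometry_affine_add[OF subspace_hermitian this]
    isometry_affine_scale[OF subspace_hermitian this]
  define Y0 where "Y0 = \<psi> 0"
  have Y0: "Y0 \<in> hermitian_ops" by (simp add: Y0_def \<psi>_hermitian hermitian_zero)
  define L where "L X = \<psi> X - Y0" for X
  interpret L: order_automorphism L
  proof
    show "bij_betw L hermitian_ops hermitian_ops"
    proof -
      have "bij_betw (\<lambda>X. X - Y0) hermitian_ops hermitian_ops"
        by (rule bij_betw_byWitness[where f' = "\<lambda>X. X + Y0"]) (auto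
          simp: hermitian_add hermitian_diff Y0)
      from bij_betw_trans[OF \<psi> this] show ?thesis
        by (simp add: L_def[abs_def] comp_def)
    qed
    show "form_le (L T) c \<longleftrightarrow> form_le T c" if "T \<in> hermitian_ops" for T c
      using form_le_\<psi>[OF hermitian_zero that] by (simp add: L_def Y0_def)
  qed (simp_all add: L_def Y0_def affine)
  obtain U where U: "clinear U \<or> conjugate_linear U" and norm: "\<And>x. norm (U x) = norm x"
    and L_outer: "\<And>x. L (outer x x) = outer (U x) (U x)"
    using L.implemented_by_isometry by blast
  have L_diag: "L (diag_op B a) = (\<Sum>e\<in>B. a e *\<^sub>R outer (U e) (U e))" for B a
    by (simp add: diag_op_def L.sum L.scale hermitian_scaleR hermitian_outer L_outer)

  \<comment> \<open>The images under U of an eigenbasis of X form an eigenbasis of L X with the same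
    eigenvalues.\<close>
  have tr_exp_L: "tr_exp (L X) = tr_exp X" if X: "X \<in> hermitian_ops" for X
  proof -
    obtain B a where B: "orthonormal_basis B" "X = diag_op B a"
      using spectral_decomposition[OF X] .
    have inj: "inj U" using isometry_bij[OF norm U] by (rule bij_is_inj)
    have "L X = diag_op (U ` B) (a \<circ> inv U)"
      using inj by (simp add: B(2) L_diag diag_op_image)
    then show ?thesis
      using inj by (simp add: B(2) tr_exp_diag_op[OF B(1)]
        tr_exp_diag_op[OF isometry_image_basis[OF U norm B(1)]]
        sum.reindex inj_on_subset)
  qed
  \<comment> \<open>The constant that \<open>ratio\<close> produces for X = 0.\<close>
  define k where "k = tr_exp Y0 / tr_exp (0 :: 'h \<Rightarrow>\<^sub>L 'h)"
  have k: "k > 0" by (simp add: k_def tr_exp_pos Y0 hermitian_zero)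
  have "tr_exp (L W + Y0) = k * tr_exp W" if W: "W \<in> hermitian_ops" for W
  proof -
    \<comment> \<open>Scaled so that, with X = 0 in \<open>ratio\<close>, the arguments of
      \<open>tr_exp\<close> are W on one side and L W + \<open>Y0\<close> on the other.\<close>
    define Y where "Y = (1 / (1 - \<alpha>)) *\<^sub>R W"
    have Y: "Y \<in> hermitian_ops" "(1 - \<alpha>) *\<^sub>R Y = W"
      using W \<alpha> by (simp_all add: Y_def hermitian_scaleR)
    have "\<alpha> *\<^sub>R \<psi> 0 + (1 - \<alpha>) *\<^sub>R \<psi> Y = (1 - \<alpha>) *\<^sub>R L Y + Y0"
      by (simp add: L_def Y0_def algebra_simps)
    also have "(1 - \<alpha>) *\<^sub>R L Y = L W"
      using L.scale[OF Y(1), of "1 - \<alpha>"] Y(2) by simp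
    finally have "G (\<psi> 0) (\<psi> Y) = tr_exp (L W + Y0)"
      by (simp add: G_def)
    moreover have "G 0 Y = tr_exp W"
      by (simp add: G_def Y)
    ultimately show ?thesis
      using ratio[OF hermitian_zero Y(1)] tr_exp_pos[OF hermitian_zero, where 'a = 'h]
        tr_exp_pos[OF Y0]
      by (simp add: k_def Y0_def field_simps)
  qed
  then have "tr_exp (Z + Y0) = k * tr_exp Z" if "Z \<in> hermitian_ops" for Z
    using that bij_betw_imp_surj_on[OF L.bij] tr_exp_L by (metis image_iff)
  then have Y0_eq: "Y0 = ln k *\<^sub>R id_blinfun"
    by (rule tr_exp_scalar_ratio[OF Y0 k])

  \<comment> \<open>Both final cases are instances of this formula, with \<open>V\<close> the
    respective adjoint; the scalar operator \<open>Y0\<close> supplies the factor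
    \<open>k\<close>.\<close>
  have \<phi>_eq: "\<phi> A x = k *\<^sub>R U (A (V x))"
    if A: "A \<in> positive_definite_ops" and adj:
      "\<And>e. U (cinner (V x) e *\<^sub>C e) = cinner x (U e) *\<^sub>C U e" for A V x
  proof -
    define X where "X = log_op A"
    have X: "X \<in> hermitian_ops" "E X = A"
      using A by (simp_all add: X_def E_def log_op_hermitian op_exp_log_op)
    have "\<phi> A \<in> positive_definite_ops"
      using assms(3) A by (rule bij_betw_apply)
    then have "\<phi> A = E (\<psi> X)"
      using X by (simp add: \<psi>_def E_def op_exp_log_op)
    obtain B a where B: "orthonormal_basis B" "X = diag_op B a"
      using spectral_decomposition[OF X(1)] .
    have "\<psi> X = (\<Sum>e\<in>B. a e *\<^sub>R outer (U e) (U e)) + ln k *\<^sub>R id_blinfun"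
      using L_diag[of B a] by (simp add: L_def B(2) Y0_eq diff_eq_eq)
    then have "E (\<psi> X) x = exp (ln k) *\<^sub>R U (E X (V x))"
      using op_exp_conjugated[where U = U and V = V and x = x, OF U norm adj B(1), of a "ln k"]
        by (simp add: E_def B(2))
    with \<open>\<phi> A = E (\<psi> X)\<close> X(2) k show ?thesis by simp
  qed
  from U show ?thesis
  proof
    assume lin: "clinear U"
    have "\<phi> A = (\<lambda>x. k *\<^sub>R U (A (cadjoint U x)))" if "A \<in> positive_definite_ops" for A
      using that by (intro ext \<phi>_eq) (simp_all
        add: clinear_scaleC[OF lin] clinear_isometry_cadjoint[OF lin norm])
    with k clinear_isometry_unitary[OF lin norm] show ?thesis by blast
  next
    assume conj: "conjugate_linear U"
    have "\<phi> A = (\<lambda>x. k *\<^sub>R U (A (antilinear_adjoint U x)))" if "A \<in> positive_definite_ops" for A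
      using that conj
      by (intro ext \<phi>_eq) (simp_all
        add: conjugate_linear_def conjugate_linear_isometry_adjoint[OF conj norm])
    with k conjugate_linear_isometry_antiunitary[OF conj norm] show ?thesis by blast
  qed
qed

end
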